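(* Let $M$ be a compact oriented Riemannian manifold (possibly with boundary), let $N=\Gamma\backslash\mathbb H^m$ be a closed oriented hyperbolic manifold, let $1<p<\infty$, and let $u\in W^{1,p}(M,N)\cap C^0(M,N)$ satisfy the $J_p$-Euler–Lagrange equations. Let $d$ be the flat connection on $ad(E)$. Then, in the distribution sense, $$d*\bigl(S_{p-1}(du)\times u\bigr)=0 ,$$ that is, $\int_M \bigl(S_{p-1}(du)\times u;\,d\phi\bigr)^\sharp *1=0$ for every smooth section $\phi$ of $ad(E)$ compactly supported in the interior of $M$ (every smooth section if $\partial M=\emptyset$).
   Context: Linear algebra. For a linear map $A:V_1\to V_2$ of finite-dimensional inner product spaces, $Q(A)=(AA^T)^{1/2}$. For $r>0$ set $S_r(A)=Q(A)^{r-1}A$; in a singular value decomposition $A=\sum_j s_j B_j\otimes b_j$ (with $s_j\ge 0$ and $b_j$, $B_j$ orthonormal in $V_1$, $V_2$) this means $S_r(A)=\sum_j s_j^{r}B_j\otimes b_j$. In particular $S_{p-1}(du)=Q(du)^{p-2}du$. Functional. $J_p(u)=\int_M \mathrm{Tr}\,Q(du)^p *1$, where $*1$ is the volume form. The $J_p$-Euler–Lagrange equations are $D^*Q(du)^{p-2}du=0$ in the weak sense: $\int_M (Q(du)^{p-2}du;D\xi)^\sharp *1=0$ for all $W^{1,p}\cap C^0$ sections $\xi$ of $u^{-1}(TN)$ compactly supported in the interior of $M$ (all such sections if $\partial M=\emptyset$), where $D$ is the pullback of the Levi-Civita connection of $N$. Hyperboloid. $\mathbb R^{m,1}$ carries $(X,Y)^\sharp=\sum_{i\le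 m}X_iY_i-X_{m+1}Y_{m+1}$. With $e^\sharp=\mathrm{diag}(1,\dots,1,-1)$ put $X^\sharp=(e^\sharp X)^T$, so $(X,Y)^\sharp=X^\sharp Y$. $\mathbb H^m=\{X:(X,X)^\sharp=-1,\ X_{m+1}\ge 1\}$ with the metric induced by $(\cdot,\cdot)^\sharp$; $SO^+(m,1)$ is its group of orientation-preserving isometries, with Lie algebra $\mathfrak g=so(m,1)$ carrying the form $(A,B)^\sharp=\mathrm{Tr}(AB)$. For $X,Y\in\mathbb R^{m,1}$, $X\times Y=YX^\sharp-XY^\sharp\in\mathfrak g$. Bundles. Let $\rho:\pi_1(M)\to\Gamma\subset SO^+(m,1)$ be induced by $u$ and let $\tilde u:\tilde M\to\mathbb H^m$ be the $\rho$-equivariant lift. $E=\tilde M\times_\rho\mathbb R^{m,1}$ and $ad(E)=\tilde M\times_{Ad(\rho)}\mathfrak g$ are flat bundles; $u$ is regarded as the section of $E$ defined by $\tilde u$, and $u^{-1}(TN)\subset E$, so $S_{p-1}(du)$ is a section of $T^*M\otimes E$ and $S_{p-1}(du)\times u$ is a section of $T^*M\otimes ad(E)$. The pairing $(\cdot;\cdot)^\sharp$ combines the metric on $T^*M$ with the form $(\cdot,\cdot)^\sharp$ on the values. *)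

theory Defs
  imports "HOL-Analysis.Analysis"
begin

section \<open>Smooth functions\<close>

fun Ck_on :: "nat \<Rightarrow> 'a::euclidean_space set \<Rightarrow> ('a \<Rightarrow> 'b::real_normed_vector) \<Rightarrow> bool" where
  "Ck_on 0 T f \<longleftrightarrow> continuous_on T f"
| "Ck_on (Suc k) T f \<longleftrightarrow> (\<forall>x\<in>T. f differentiable (at x)) \<and>
     (\<forall>v. Ck_on k T (\<lambda>x. frechet_derivative f (at x) v))"

text \<open>Smoothness on a set that need not be open (a relatively open subset of a half-space below):
  local extendability to a smooth function on an open set.\<close>

definition smooth_on :: "'a::euclidean_space set \<Rightarrow> ('a \<Rightarrow> 'b::real_normed_vector) \<Rightarrow> bool" where
  "smooth_on S f \<longleftrightarrow> (\<forall>x\<in>S. \<exists>T F. open T \<and> x \<in> T \<and> (\<forall>k. Ck_on k T F) \<and> (\<forall>y\<in>S \<inter> T. F y = f y))"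


section \<open>Linear algebra\<close>

text \<open>All notions are relative to a subspace \<open>W\<close> with an inner product \<open>h\<close>, because the target of
  the differential of a map into the hyperboloid is the tangent space, on which the (indefinite)
  Minkowski form restricts to an inner product.\<close>

definition inner_product_on :: "'v::euclidean_space set \<Rightarrow> ('v \<Rightarrow> 'v \<Rightarrow> real) \<Rightarrow> bool" where
  "inner_product_on W h \<longleftrightarrow> subspace W \<and>
     (\<forall>x\<in>W. \<forall>y\<in>W. h x y = h y x) \<and>
     (\<forall>x\<in>W. \<forall>y\<in>W. \<forall>z\<in>W. \<forall>a b. h (a *\<^sub>R x + b *\<^sub>R y) z = a * h x z + b * h y z) \<and>
     (\<forall>x\<in>W. x \<noteq> 0 \<longrightarrow> h x x > 0)"

definition orthonormal_basis :: "'v::euclidean_space set \<Rightarrow> ('v \<Rightarrow> 'v \<Rightarrow> real) \<Rightarrow> 'v set \<Rightarrow> bool" where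
  "orthonormal_basis W h B \<longleftrightarrow> finite B \<and> B \<subseteq> W \<and> span B = W \<and>
     (\<forall>b\<in>B. \<forall>b'\<in>B. h b b' = (if b = b' then 1 else 0))"

text \<open>The transpose \<open>W \<rightarrow> 'n\<close> of \<open>A : ('n, g) \<rightarrow> (W, h)\<close>.\<close>

definition adjoint_map ::
  "('n::euclidean_space \<Rightarrow> 'n \<Rightarrow> real) \<Rightarrow> ('v \<Rightarrow> 'v \<Rightarrow> real) \<Rightarrow> ('n \<Rightarrow> 'v) \<Rightarrow> 'v::euclidean_space \<Rightarrow> 'n"
  where "adjoint_map g h A w = (THE v. \<forall>v'. g v v' = h w (A v'))"

text \<open>The power \<open>T\<^sup>a\<close> of a positive semidefinite operator \<open>T\<close> on \<open>(W, h)\<close>, computed in an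
  orthonormal eigenbasis of \<open>T\<close>; the eigenvalue at \<open>b\<close> is \<open>h (T b) b\<close> and the result does not
  depend on the eigenbasis.  Since \<open>0 powr a = 0\<close>, the kernel of \<open>T\<close> is sent to \<open>0\<close> for every \<open>a\<close>,
  also for \<open>a \<le> 0\<close>.\<close>

definition psd_powr ::
  "'v::euclidean_space set \<Rightarrow> ('v \<Rightarrow> 'v \<Rightarrow> real) \<Rightarrow> ('v \<Rightarrow> 'v) \<Rightarrow> real \<Rightarrow> 'v \<Rightarrow> 'v" where
  "psd_powr W h T a =
     (let B = (SOME B. orthonormal_basis W h B \<and> (\<forall>b\<in>B. T b = h (T b) b *\<^sub>R b))
      in (\<lambda>w. \<Sum>b\<in>B. (h (T b) b powr a * h b w) *\<^sub>R b))"

definition Q_op ::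
  "('n::euclidean_space \<Rightarrow> 'n \<Rightarrow> real) \<Rightarrow> 'v::euclidean_space set \<Rightarrow> ('v \<Rightarrow> 'v \<Rightarrow> real) \<Rightarrow> ('n \<Rightarrow> 'v) \<Rightarrow> 'v \<Rightarrow> 'v"
  where "Q_op g W h A = psd_powr W h (A \<circ> adjoint_map g h A) (1/2)"

text \<open>\<open>S_r(A) = Q(A)\<^sup>r\<^sup>-\<^sup>1 A\<close>.  The range of \<open>A\<close> is orthogonal to the kernel of \<open>Q(A)\<close>, so the
  convention on the kernel is irrelevant: in a singular value decomposition the \<open>s_j\<close> become
  \<open>s_j powr r\<close>.\<close>

definition S_op ::
  "('n::euclidean_space \<Rightarrow> 'n \<Rightarrow> real) \<Rightarrow> 'v::euclidean_space set \<Rightarrow> ('v \<Rightarrow> 'v \<Rightarrow> real) \<Rightarrow> real \<Rightarrow> ('n \<Rightarrow> 'v) \<Rightarrow> 'n \<Rightarrow> 'v"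
  where "S_op g W h r A = psd_powr W h (Q_op g W h A) (r - 1) \<circ> A"

text \<open>The pairing on \<open>T\<^sup>* \<otimes> V\<close> induced by the metric \<open>g\<close> on \<open>T\<close> and a bilinear form \<open>h\<close> on \<open>V\<close>.\<close>

definition form_pairing ::
  "('n::euclidean_space \<Rightarrow> 'n \<Rightarrow> real) \<Rightarrow> ('v \<Rightarrow> 'v \<Rightarrow> real) \<Rightarrow> ('n \<Rightarrow> 'v) \<Rightarrow> ('n \<Rightarrow> 'v) \<Rightarrow> real" where
  "form_pairing g h A B = (\<Sum>b\<in>(SOME B. orthonormal_basis UNIV g B). h (A b) (B b))"


section \<open>The hyperboloid and closed hyperbolic manifolds\<close>

text \<open>Coordinates of \<open>\<real>\<^sup>m\<^sup>,\<^sup>1\<close> are indexed by \<open>'m option\<close>: \<open>Some i\<close> are the \<open>m = CARD('m)\<close> spacelike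
  directions and \<open>None\<close> is the coordinate with number \<open>m + 1\<close>.\<close>

type_synonym 'm mink = "real ^ ('m option)"
type_synonym 'm mink_mat = "real ^ ('m option) ^ ('m option)"

definition e_sharp :: "('m::finite) mink_mat" where
  "e_sharp = (\<chi> i j. if i = j then (if i = None then - 1 else 1) else 0)"

definition mink :: "('m::finite) mink \<Rightarrow> 'm mink \<Rightarrow> real" where
  "mink X Y = (\<Sum>i\<in>UNIV. X $ Some i * Y $ Some i) - X $ None * Y $ None"

definition hyperboloid :: "('m::finite) mink set" where
  "hyperboloid = {X. mink X X = - 1 \<and> X $ None \<ge> 1}"

definition tangent_hyperboloid :: "('m::finite) mink \<Rightarrow> 'm mink set" where
  "tangent_hyperboloid X = {v. mink v X = 0}"

text \<open>The entries of \<open>YX\<^sup>\<sharp> - XY\<^sup>\<sharp>\<close>, where \<open>X\<^sup>\<sharp>\<close> is the row vector \<open>(e\<^sup>\<sharp> X)\<^sup>T\<close>.\<close>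

definition mink_cross :: "('m::finite) mink \<Rightarrow> 'm mink \<Rightarrow> 'm mink_mat" where
  "mink_cross X Y = (\<chi> i j. Y $ i * (e_sharp *v X) $ j - X $ i * (e_sharp *v Y) $ j)"

definition so_mink :: "('m::finite) mink_mat set" where
  "so_mink = {A. transpose A ** e_sharp + e_sharp ** A = 0}"

definition SO_plus :: "('m::finite) mink_mat set" where
  "SO_plus = {R. transpose R ** e_sharp ** R = e_sharp \<and> det R = 1 \<and> R $ None $ None > 0}"

definition Gamma_orbit :: "('m::finite) mink_mat set \<Rightarrow> 'm mink \<Rightarrow> 'm mink set" where
  "Gamma_orbit \<Gamma> X = (\<lambda>R. R *v X) ` \<Gamma>"

text \<open>\<open>\<Gamma>\<setminus>\<H>\<^sup>m\<close>: the set of orbits with the quotient topology.\<close>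

definition hyp_quotient :: "('m::finite) mink_mat set \<Rightarrow> 'm mink set topology" where
  "hyp_quotient \<Gamma> = topology (\<lambda>W. W \<subseteq> Gamma_orbit \<Gamma> ` hyperboloid \<and>
     openin (top_of_set hyperboloid) {X \<in> hyperboloid. Gamma_orbit \<Gamma> X \<in> W})"

text \<open>\<open>\<Gamma>\<setminus>\<H>\<^sup>m\<close> is a closed oriented hyperbolic manifold: \<open>\<Gamma>\<close> is a group of orientation preserving
  isometries acting freely and properly discontinuously with compact quotient.\<close>

definition closed_hyperbolic :: "('m::finite) mink_mat set \<Rightarrow> bool" where
  "closed_hyperbolic \<Gamma> \<longleftrightarrow>
     \<Gamma> \<subseteq> SO_plus \<and> mat 1 \<in> \<Gamma> \<and> (\<forall>R\<in>\<Gamma>. \<forall>R'\<in>\<Gamma>. R ** R' \<in> \<Gamma>) \<and> (\<forall>R\<in>\<Gamma>. matrix_inv R \<in> \<Gamma>) \<and>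
     (\<forall>R\<in>\<Gamma>. \<forall>X\<in>hyperboloid. R *v X = X \<longrightarrow> R = mat 1) \<and>
     (\<forall>K. compact K \<and> K \<subseteq> hyperboloid \<longrightarrow> finite {R\<in>\<Gamma>. (\<lambda>X. R *v X) ` K \<inter> K \<noteq> {}}) \<and>
     compact_space (hyp_quotient \<Gamma>)"


section \<open>Oriented Riemannian manifolds with boundary\<close>

text \<open>A chart is a pair \<open>(U, f)\<close>.  Its image is relatively open in \<open>{y. 0 \<le> a \<bullet> y}\<close>, which is a
  closed half-space for \<open>a \<noteq> 0\<close> and the whole space for \<open>a = 0\<close>.  The half-space may vary with the
  chart, so that also one-dimensional manifolds with boundary have oriented atlases.\<close>

type_synonym ('a, 'n) chart = "'a set \<times> ('a \<Rightarrow> real ^ 'n)"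

definition oriented_manifold ::
  "'a::topological_space set \<Rightarrow> ('a, 'n::finite) chart set \<Rightarrow> bool" where
  "oriented_manifold M \<A> \<longleftrightarrow>
     (\<Union>(U, f)\<in>\<A>. U) = M \<and>
     (\<forall>(U, f)\<in>\<A>. openin (top_of_set M) U \<and> (\<exists>f'. homeomorphism U (f ` U) f f') \<and>
        (\<exists>a. openin (top_of_set {y. 0 \<le> a \<bullet> y}) (f ` U))) \<and>
     (\<forall>(U, f)\<in>\<A>. \<forall>(U', f')\<in>\<A>.
        smooth_on (f ` (U \<inter> U')) (f' \<circ> inv_into U f) \<and>
        (\<forall>y\<in>f ` (U \<inter> U').
           det (matrix (frechet_derivative (f' \<circ> inv_into U f) (at y within f ` (U \<inter> U')))) > 0))"

definition manifold_interior :: "('a::topological_space, 'n::finite) chart set \<Rightarrow> 'a set" where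
  "manifold_interior \<A> = (\<Union>(U, f)\<in>\<A>. {x\<in>U. f x \<in> interior (f ` U)})"

text \<open>The tangent space at \<open>x\<close> is modelled on \<open>\<real>\<^sup>n\<close> through one fixed chart \<open>chart_at \<A> x\<close> around \<open>x\<close>.
  Tensor fields are thus functions on the manifold; their expressions in an arbitrary chart
  are obtained with \<open>to_tangent\<close>, the differential of the coordinate change from that chart to
  \<open>chart_at \<A> x\<close>, and are subject to the regularity conditions.  No regularity of
  \<open>x \<mapsto> chart_at \<A> x\<close> is needed.\<close>

definition chart_at :: "('a, 'n::finite) chart set \<Rightarrow> 'a \<Rightarrow> ('a, 'n) chart" where
  "chart_at \<A> x = (SOME c. c \<in> \<A> \<and> x \<in> fst c)"

definition to_tangent ::
  "('a, 'n::finite) chart set \<Rightarrow> ('a, 'n) chart \<Rightarrow> 'a \<Rightarrow> real ^ 'n \<Rightarrow> real ^ 'n" where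
  "to_tangent \<A> c x = frechet_derivative (snd (chart_at \<A> x) \<circ> inv_into (fst c) (snd c))
     (at (snd c x) within snd c ` (fst c \<inter> fst (chart_at \<A> x)))"

type_synonym ('a, 'n) metric = "'a \<Rightarrow> real ^ 'n \<Rightarrow> real ^ 'n \<Rightarrow> real"

definition metric_in_chart ::
  "('a, 'n::finite) chart set \<Rightarrow> ('a, 'n) metric \<Rightarrow> ('a, 'n) chart \<Rightarrow> real ^ 'n \<Rightarrow> real ^ 'n \<Rightarrow> real ^ 'n \<Rightarrow> real" where
  "metric_in_chart \<A> g c y v w =
     (let x = inv_into (fst c) (snd c) y in g x (to_tangent \<A> c x v) (to_tangent \<A> c x w))"

definition riemannian_metric ::
  "'a set \<Rightarrow> ('a, 'n::finite) chart set \<Rightarrow> ('a, 'n) metric \<Rightarrow> bool" where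
  "riemannian_metric M \<A> g \<longleftrightarrow>
     (\<forall>x\<in>M. inner_product_on UNIV (g x)) \<and>
     (\<forall>c\<in>\<A>. \<forall>v w. smooth_on (snd c ` fst c) (\<lambda>y. metric_in_chart \<A> g c y v w))"

text \<open>Integration of functions against the volume form: the unique measure on the Borel sets of \<open>M\<close>
  with density \<open>sqrt (det g\<^sub>i\<^sub>j)\<close> in every chart.\<close>

definition riemannian_volume ::
  "'a::topological_space set \<Rightarrow> ('a, 'n::finite) chart set \<Rightarrow> ('a, 'n) metric \<Rightarrow> 'a measure" where
  "riemannian_volume M \<A> g = (THE \<mu>.
     space \<mu> = M \<and> sets \<mu> = sets (restrict_space borel M) \<and>
     (\<forall>(U, f)\<in>\<A>. \<forall>B\<in>sets \<mu>. B \<subseteq> U \<longrightarrow> emeasure \<mu> B =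
        (\<integral>\<^sup>+ y. ennreal (sqrt (det (\<chi> i j. metric_in_chart \<A> g (U, f) y (axis i 1) (axis j 1))))
           * indicator (f ` B) y \<partial>lborel)))"


section \<open>Flat bundles over a universal covering\<close>

text \<open>Here \<open>\<pi> : Mt \<rightarrow> M\<close> is a universal covering, \<open>\<pi>\<^sub>1(M)\<close> is its group of deck transformations and
  \<open>\<rho>\<close> a representation of it.  Sections of a flat bundle \<open>Mt \<times>\<^sub>\<rho> V\<close> are the \<open>\<rho>\<close>-equivariant functions
  \<open>Mt \<rightarrow> V\<close>, and bundle-valued one-forms are the equivariant \<open>V\<close>-valued one-forms on \<open>Mt\<close>; the flat
  connection is the ordinary differential.  The tangent space of \<open>Mt\<close> at \<open>x\<close> is identified with that
  of \<open>M\<close> at \<open>\<pi> x\<close>, so deck transformations have the identity as their differential.\<close>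

definition deck_group :: "'c::topological_space set \<Rightarrow> ('c \<Rightarrow> 'a) \<Rightarrow> ('c \<Rightarrow> 'c) set" where
  "deck_group Mt \<pi> = {\<gamma>. (\<exists>\<delta>. homeomorphism Mt Mt \<gamma> \<delta>) \<and> (\<forall>x\<in>Mt. \<pi> (\<gamma> x) = \<pi> x)}"

definition adjoint_action :: "('m::finite) mink_mat \<Rightarrow> 'm mink_mat \<Rightarrow> 'm mink_mat" where
  "adjoint_action R F = R ** F ** matrix_inv R"

definition bundle_section ::
  "'c::topological_space set \<Rightarrow> ('c \<Rightarrow> 'a) \<Rightarrow> (('c \<Rightarrow> 'c) \<Rightarrow> ('m::finite) mink_mat) \<Rightarrow>
   ('m mink_mat \<Rightarrow> 'v \<Rightarrow> 'v) \<Rightarrow> ('c \<Rightarrow> 'v) \<Rightarrow> bool" where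
  "bundle_section Mt \<pi> \<rho> act s \<longleftrightarrow> (\<forall>\<gamma>\<in>deck_group Mt \<pi>. \<forall>x\<in>Mt. s (\<gamma> x) = act (\<rho> \<gamma>) (s x))"

definition bundle_one_form ::
  "'c::topological_space set \<Rightarrow> ('c \<Rightarrow> 'a) \<Rightarrow> (('c \<Rightarrow> 'c) \<Rightarrow> ('m::finite) mink_mat) \<Rightarrow>
   ('m mink_mat \<Rightarrow> 'v \<Rightarrow> 'v) \<Rightarrow> ('c \<Rightarrow> real ^ 'n \<Rightarrow> 'v::real_vector) \<Rightarrow> bool" where
  "bundle_one_form Mt \<pi> \<rho> act \<omega> \<longleftrightarrow> (\<forall>x\<in>Mt. linear (\<omega> x)) \<and>
     (\<forall>\<gamma>\<in>deck_group Mt \<pi>. \<forall>x\<in>Mt. \<forall>v. \<omega> (\<gamma> x) v = act (\<rho> \<gamma>) (\<omega> x v))"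

text \<open>The charts of \<open>Mt\<close> induced by those of \<open>M\<close>: \<open>(V, (U, f))\<close> stands for \<open>f \<circ> \<pi>\<close> on \<open>V\<close>.\<close>

definition lifted_charts ::
  "'c::topological_space set \<Rightarrow> ('c \<Rightarrow> 'a) \<Rightarrow> ('a, 'n::finite) chart set \<Rightarrow> ('c set \<times> ('a, 'n) chart) set" where
  "lifted_charts Mt \<pi> \<A> = {(V, c). c \<in> \<A> \<and> openin (top_of_set Mt) V \<and> inj_on \<pi> V \<and> \<pi> ` V \<subseteq> fst c}"

definition chart_image :: "('c \<Rightarrow> 'a) \<Rightarrow> 'c set \<Rightarrow> ('a, 'n::finite) chart \<Rightarrow> (real ^ 'n) set" where
  "chart_image \<pi> V c = (snd c \<circ> \<pi>) ` V"

definition fun_in_chart ::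
  "('c \<Rightarrow> 'a) \<Rightarrow> 'c set \<Rightarrow> ('a, 'n::finite) chart \<Rightarrow> ('c \<Rightarrow> 'v) \<Rightarrow> real ^ 'n \<Rightarrow> 'v" where
  "fun_in_chart \<pi> V c s y = s (inv_into V (snd c \<circ> \<pi>) y)"

definition form_in_chart ::
  "('a, 'n::finite) chart set \<Rightarrow> ('c \<Rightarrow> 'a) \<Rightarrow> 'c set \<Rightarrow> ('a, 'n) chart \<Rightarrow>
   ('c \<Rightarrow> real ^ 'n \<Rightarrow> 'v) \<Rightarrow> real ^ 'n \<Rightarrow> real ^ 'n \<Rightarrow> 'v" where
  "form_in_chart \<A> \<pi> V c \<omega> y v =
     (let x = inv_into V (snd c \<circ> \<pi>) y in \<omega> x (to_tangent \<A> c (\<pi> x) v))"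

definition smooth_section ::
  "('a, 'n::finite) chart set \<Rightarrow> 'c::topological_space set \<Rightarrow> ('c \<Rightarrow> 'a) \<Rightarrow> ('c \<Rightarrow> 'v::real_normed_vector) \<Rightarrow> bool"
  where
  "smooth_section \<A> Mt \<pi> s \<longleftrightarrow>
     (\<forall>(V, c)\<in>lifted_charts Mt \<pi> \<A>. smooth_on (chart_image \<pi> V c) (fun_in_chart \<pi> V c s))"

text \<open>\<open>\<omega> = ds\<close>; this determines \<open>\<omega>\<close> on \<open>Mt\<close>.\<close>

definition is_differential ::
  "('a, 'n::finite) chart set \<Rightarrow> 'c::topological_space set \<Rightarrow> ('c \<Rightarrow> 'a) \<Rightarrow> ('c \<Rightarrow> 'v::real_normed_vector) \<Rightarrow>
   ('c \<Rightarrow> real ^ 'n \<Rightarrow> 'v) \<Rightarrow> bool" where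
  "is_differential \<A> Mt \<pi> s \<omega> \<longleftrightarrow>
     (\<forall>(V, c)\<in>lifted_charts Mt \<pi> \<A>. \<forall>y\<in>chart_image \<pi> V c.
        (fun_in_chart \<pi> V c s has_derivative form_in_chart \<A> \<pi> V c \<omega> y) (at y within chart_image \<pi> V c))"

definition test_function :: "(real ^ 'n::finite) set \<Rightarrow> (real ^ 'n \<Rightarrow> real) \<Rightarrow> bool" where
  "test_function \<Omega> \<eta> \<longleftrightarrow> (\<forall>k. Ck_on k UNIV \<eta>) \<and> (\<exists>K. compact K \<and> K \<subseteq> \<Omega> \<and> (\<forall>y. y \<notin> K \<longrightarrow> \<eta> y = 0))"

text \<open>\<open>s\<close> is a \<open>W\<^sup>1\<^sup>,\<^sup>p \<inter> C\<^sup>0\<close> section and \<open>\<omega>\<close> a Borel representative of its weak differential.  The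
  \<open>L\<^sup>p\<close> condition is imposed on compact subsets of the chart images, which may contain boundary
  points; as \<open>M\<close> is compact this is the global \<open>L\<^sup>p\<close> condition on \<open>M\<close>, for any fibre metric.\<close>

definition W1p_C0 ::
  "('a, 'n::finite) chart set \<Rightarrow> 'c::topological_space set \<Rightarrow> ('c \<Rightarrow> 'a) \<Rightarrow> real \<Rightarrow> ('c \<Rightarrow> 'v::euclidean_space) \<Rightarrow>
   ('c \<Rightarrow> real ^ 'n \<Rightarrow> 'v) \<Rightarrow> bool" where
  "W1p_C0 \<A> Mt \<pi> p s \<omega> \<longleftrightarrow> continuous_on Mt s \<and>
     (\<forall>(V, c)\<in>lifted_charts Mt \<pi> \<A>.
        let F = fun_in_chart \<pi> V c s; G = form_in_chart \<A> \<pi> V c \<omega> in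
        (\<forall>K v. compact K \<and> K \<subseteq> chart_image \<pi> V c \<longrightarrow>
           set_borel_measurable lborel K (\<lambda>y. G y v) \<and>
           set_integrable lborel K (\<lambda>y. norm (G y v) powr p)) \<and>
        (\<forall>\<eta> v. test_function (interior (chart_image \<pi> V c)) \<eta> \<longrightarrow>
           (LINT y|lborel. frechet_derivative \<eta> (at y) v *\<^sub>R F y) = - (LINT y|lborel. \<eta> y *\<^sub>R G y v)))"

text \<open>Support of a section in the interior; the support is closed in the compact space \<open>M\<close>, hence
  compact, and the condition is void if the boundary is empty.\<close>

definition supported_in_interior ::
  "'a::topological_space set \<Rightarrow> ('a, 'n::finite) chart set \<Rightarrow> 'c set \<Rightarrow> ('c \<Rightarrow> 'a) \<Rightarrow> ('c \<Rightarrow> 'v::zero) \<Rightarrow> bool" where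
  "supported_in_interior M \<A> Mt \<pi> s \<longleftrightarrow> M \<inter> closure (\<pi> ` {x\<in>Mt. s x \<noteq> 0}) \<subseteq> manifold_interior \<A>"

text \<open>Integral over \<open>M\<close> of a function on \<open>Mt\<close> that is invariant under deck transformations.\<close>

definition integral_M ::
  "'a::topological_space set \<Rightarrow> ('a, 'n::finite) chart set \<Rightarrow> ('a, 'n) metric \<Rightarrow> 'c set \<Rightarrow> ('c \<Rightarrow> 'a) \<Rightarrow>
   ('c \<Rightarrow> real) \<Rightarrow> real" where
  "integral_M M \<A> g Mt \<pi> h = (LINT x|riemannian_volume M \<A> g. h (SOME xt. xt \<in> Mt \<and> \<pi> xt = x))"


section \<open>Maps to a hyperbolic manifold and the Euler-Lagrange equations\<close>

text \<open>\<open>\<rho>\<close> is the representation induced by \<open>u : M \<rightarrow> \<Gamma>\<setminus>\<H>\<^sup>m\<close> and \<open>ut\<close> the \<open>\<rho>\<close>-equivariant lift.\<close>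

definition equivariant_lift ::
  "'c::topological_space set \<Rightarrow> ('c \<Rightarrow> 'a) \<Rightarrow> ('m::finite) mink_mat set \<Rightarrow> ('a \<Rightarrow> 'm mink set) \<Rightarrow>
   (('c \<Rightarrow> 'c) \<Rightarrow> 'm mink_mat) \<Rightarrow> ('c \<Rightarrow> 'm mink) \<Rightarrow> bool" where
  "equivariant_lift Mt \<pi> \<Gamma> u \<rho> ut \<longleftrightarrow>
     continuous_on Mt ut \<and> ut ` Mt \<subseteq> hyperboloid \<and> (\<forall>x\<in>Mt. Gamma_orbit \<Gamma> (ut x) = u (\<pi> x)) \<and>
     \<rho> ` deck_group Mt \<pi> \<subseteq> \<Gamma> \<and>
     (\<forall>\<gamma>\<in>deck_group Mt \<pi>. \<forall>\<delta>\<in>deck_group Mt \<pi>. \<rho> (\<gamma> \<circ> \<delta>) = \<rho> \<gamma> ** \<rho> \<delta>) \<and>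
     bundle_section Mt \<pi> \<rho> (*v) ut"

text \<open>\<open>u \<in> W\<^sup>1\<^sup>,\<^sup>p(M, N) \<inter> C\<^sup>0(M, N)\<close> with weak differential \<open>du\<close>, a section of
  \<open>T\<^sup>*M \<otimes> u\<^sup>-\<^sup>1(TN)\<close>.\<close>

definition W1p_C0_map ::
  "('a, 'n::finite) chart set \<Rightarrow> 'c::topological_space set \<Rightarrow> ('c \<Rightarrow> 'a) \<Rightarrow> (('c \<Rightarrow> 'c) \<Rightarrow> ('m::finite) mink_mat) \<Rightarrow>
   real \<Rightarrow> ('c \<Rightarrow> 'm mink) \<Rightarrow> ('c \<Rightarrow> real ^ 'n \<Rightarrow> 'm mink) \<Rightarrow> bool" where
  "W1p_C0_map \<A> Mt \<pi> \<rho> p ut du \<longleftrightarrow>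
     bundle_one_form Mt \<pi> \<rho> (*v) du \<and> W1p_C0 \<A> Mt \<pi> p ut du \<and>
     (\<forall>x\<in>Mt. range (du x) \<subseteq> tangent_hyperboloid (ut x))"

text \<open>\<open>S_r(du)\<close>, with \<open>du x\<close> regarded as a map of inner product spaces \<open>T\<^sub>xM \<rightarrow> T\<^sub>u\<^sub>(\<^sub>x\<^sub>)\<H>\<^sup>m\<close>.\<close>

definition S_du ::
  "('a, 'n::finite) metric \<Rightarrow> ('c \<Rightarrow> 'a) \<Rightarrow> real \<Rightarrow> ('c \<Rightarrow> ('m::finite) mink) \<Rightarrow> ('c \<Rightarrow> real ^ 'n \<Rightarrow> 'm mink) \<Rightarrow>
   'c \<Rightarrow> real ^ 'n \<Rightarrow> 'm mink" where
  "S_du g \<pi> r ut du x = S_op (g (\<pi> x)) (tangent_hyperboloid (ut x)) mink r (du x)"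

text \<open>The pullback of the Levi-Civita connection applied to a section of \<open>u\<^sup>-\<^sup>1(TN)\<close> with flat
  differential \<open>d\<xi>\<close>: the tangential component of \<open>d\<xi>\<close> along the submanifold \<open>\<H>\<^sup>m\<close>.  Since
  \<open>mink (ut x) (ut x) = - 1\<close>, the projection to the tangent space is \<open>Y \<mapsto> Y + mink Y (ut x) (ut x)\<close>.\<close>

definition pullback_LC ::
  "('c \<Rightarrow> ('m::finite) mink) \<Rightarrow> ('c \<Rightarrow> real ^ 'n \<Rightarrow> 'm mink) \<Rightarrow> 'c \<Rightarrow> real ^ 'n \<Rightarrow> 'm mink" where
  "pullback_LC ut d\<xi> x v = d\<xi> x v + mink (d\<xi> x v) (ut x) *\<^sub>R ut x"

definition Jp_Euler_Lagrange ::
  "'a::topological_space set \<Rightarrow> ('a, 'n::finite) chart set \<Rightarrow> ('a, 'n) metric \<Rightarrow> 'c::topological_space set \<Rightarrow>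
   ('c \<Rightarrow> 'a) \<Rightarrow> (('c \<Rightarrow> 'c) \<Rightarrow> ('m::finite) mink_mat) \<Rightarrow> real \<Rightarrow> ('c \<Rightarrow> 'm mink) \<Rightarrow>
   ('c \<Rightarrow> real ^ 'n \<Rightarrow> 'm mink) \<Rightarrow> bool" where
  "Jp_Euler_Lagrange M \<A> g Mt \<pi> \<rho> p ut du \<longleftrightarrow>
     (\<forall>\<xi> d\<xi>. bundle_section Mt \<pi> \<rho> (*v) \<xi> \<and> (\<forall>x\<in>Mt. \<xi> x \<in> tangent_hyperboloid (ut x)) \<and>
        bundle_one_form Mt \<pi> \<rho> (*v) d\<xi> \<and> W1p_C0 \<A> Mt \<pi> p \<xi> d\<xi> \<and>
        supported_in_interior M \<A> Mt \<pi> \<xi> \<longrightarrow>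
        integral_M M \<A> g Mt \<pi> (\<lambda>x. form_pairing (g (\<pi> x)) mink
          (S_du g \<pi> (p - 1) ut du x) (pullback_LC ut d\<xi> x)) = 0)"

text \<open>\<open>d*\<omega> = 0\<close> in the distribution sense for an \<open>ad(E)\<close>-valued one-form \<open>\<omega>\<close>.\<close>

definition weakly_coclosed_ad ::
  "'a::topological_space set \<Rightarrow> ('a, 'n::finite) chart set \<Rightarrow> ('a, 'n) metric \<Rightarrow> 'c::topological_space set \<Rightarrow>
   ('c \<Rightarrow> 'a) \<Rightarrow> (('c \<Rightarrow> 'c) \<Rightarrow> ('m::finite) mink_mat) \<Rightarrow> ('c \<Rightarrow> real ^ 'n \<Rightarrow> 'm mink_mat) \<Rightarrow> bool" where
  "weakly_coclosed_ad M \<A> g Mt \<pi> \<rho> \<omega> \<longleftrightarrow>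
     (\<forall>\<phi> d\<phi>. bundle_section Mt \<pi> \<rho> adjoint_action \<phi> \<and> (\<forall>x\<in>Mt. \<phi> x \<in> so_mink) \<and>
        smooth_section \<A> Mt \<pi> \<phi> \<and>
        bundle_one_form Mt \<pi> \<rho> adjoint_action d\<phi> \<and> is_differential \<A> Mt \<pi> \<phi> d\<phi> \<and>
        supported_in_interior M \<A> Mt \<pi> \<phi> \<longrightarrow>
        integral_M M \<A> g Mt \<pi> (\<lambda>x. form_pairing (g (\<pi> x)) (\<lambda>F G. trace (F ** G)) (\<omega> x) (d\<phi> x)) = 0)"

end

theory Submission
  imports Defs
begin

text \<open>A section \<open>\<phi>\<close> of \<open>ad(E)\<close> gives the variation \<open>\<xi> = \<phi> u\<close>, an infinitesimal isometry evaluated along \<open>u\<close>.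
  It is tangent to the hyperboloid because \<open>\<phi>\<close> is skew, and it is of class \<open>W\<^sup>1\<^sup>,\<^sup>p \<inter> C\<^sup>0\<close> with weak
  differential \<open>d\<phi> u + \<phi> du\<close>.  Against \<open>S\<^sub>p\<^sub>-\<^sub>1(du)\<close> the term \<open>\<phi> du\<close> pairs to \<open>0\<close>: in a singular value
  decomposition the pairing is \<open>\<Sum> s\<^sub>j\<^sup>p (B\<^sub>j, \<phi> B\<^sub>j)\<close>, and \<open>\<phi>\<close> is skew.  The term \<open>d\<phi> u\<close> pairs to half the
  pairing of \<open>S\<^sub>p\<^sub>-\<^sub>1(du) \<times> u\<close> with \<open>d\<phi>\<close> under the trace form, so the Euler-Lagrange equation for \<open>\<xi>\<close>
  is the claim.\<close>

section \<open>Spectral theorem relative to a subspace\<close>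

text \<open>\<open>psd_powr\<close> works in whichever orthonormal eigenbasis the choice operator
  returns, so nothing can be computed from it until such a basis is known to exist, and this on a
  tangent space, where the restriction of the indefinite form \<open>mink\<close> is positive.
  \<open>S_op\<close> applies it to \<open>Q(A)\<close> and not to \<open>A A\<^sup>T\<close>; the
  basis obtained is tied back to \<open>A A\<^sup>T\<close> through
  \<open>Q(A)\<^sup>2 = A A\<^sup>T\<close>. The Euler-Lagrange equations contain the Levi-Civita
  derivative, the claim the flat one. They differ by a multiple of \<open>ut\<close>, normal to the
  hyperboloid, and \<open>S\<^sub>p\<^sub>-\<^sub>1(du)\<close> is tangent, so the difference pairs
  to 0. Chart images may contain boundary points. Derivatives there are taken within a relatively
  open subset of a half-space and must be shown unique and continuous up to the boundary: the
  \<open>L\<^sup>p\<close> bounds concern compact sets that may reach the boundary, the weak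
  equation only the interior. The factor one half arises because the two rank-one terms of the cross
  product contribute equally against a skew matrix.\<close>

lemma inner_product_onD:
  assumes "inner_product_on W h"
  shows "subspace W"
    and "\<And>x y. x \<in> W \<Longrightarrow> y \<in> W \<Longrightarrow> h x y = h y x"
    and "\<And>x. x \<in> W \<Longrightarrow> x \<noteq> 0 \<Longrightarrow> h x x > 0"
  using assms unfolding inner_product_on_def by auto

lemma inner_product_on_subspace:
  assumes "inner_product_on W h" "subspace W'" "W' \<subseteq> W"
  shows "inner_product_on W' h"
  using assms unfolding inner_product_on_def by (meson subsetD)

lemma inner_product_on_UNIV_bilinear:
  assumes "inner_product_on UNIV h"
  shows "bilinear h"
proof -
  have lin: "h (a *\<^sub>R x + b *\<^sub>R y) z = a * h x z + b * h y z" and sym: "h x y = h y x" for a b x y z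
    using assms by (auto simp: inner_product_on_def)
  have "linear (\<lambda>x. h x z)" for z
    using lin[of 1 _ 1] lin[of _ _ 0] by (intro linearI) auto
  then show ?thesis
    by (simp add: bilinear_def sym)
qed

text \<open>A maximiser \<open>x\<close> of the Rayleigh quotient \<open>h (T x) x / h x x\<close>
  is an eigenvector. The maximum is taken over the Euclidean unit sphere of \<open>W\<close>, which
  is compact; the quotient is homogeneous of degree 0, so this sphere may replace that of
  \<open>h\<close>. The form \<open>q y = R x * h y y - h (T y) y\<close> is then nonnegative on
  \<open>W\<close> and vanishes at \<open>x\<close>, which puts \<open>x\<close> in its
  kernel.\<close>

lemma self_adjoint_eigenvector:
  fixes W :: "'v::euclidean_space set"
  assumes ip: "inner_product_on W h" and bil: "bilinear h" and lin: "linear T"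
    and TW: "\<And>x. x \<in> W \<Longrightarrow> T x \<in> W"
    and sa: "\<And>x y. x \<in> W \<Longrightarrow> y \<in> W \<Longrightarrow> h (T x) y = h x (T y)"
    and nz: "W \<noteq> {0}"
  obtains b c where "b \<in> W" "h b b = 1" "T b = c *\<^sub>R b"
proof -
  note W = inner_product_onD[OF ip]
  have bb: "bounded_bilinear h"
    using bil by (simp add: bilinear_conv_bounded_bilinear)
  interpret h: bounded_bilinear h by (fact bb)
  have [simp]: "h x (r *\<^sub>R y) = r * h x y" "h (r *\<^sub>R x) y = r * h x y" for x y r
    by (simp_all add: h.scaleR_left h.scaleR_right)
  interpret T: linear T by (fact lin)
  have contT: "continuous_on S T" for S
    using lin by (simp add: linear_continuous_on linear_linear)
  define R where "R \<equiv> \<lambda>x. h (T x) x / h x x"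
  let ?S = "W \<inter> sphere 0 1"
  have "compact ?S"
    by (simp add: W(1) closed_Int_compact closed_subspace)
  moreover obtain w where w: "w \<in> W" "w \<noteq> 0"
    using nz W(1) subspace_0 by blast
  then have "(1 / norm w) *\<^sub>R w \<in> ?S"
    using W(1) by (simp add: subspace_scale)
  moreover have "continuous_on ?S R"
    unfolding R_def using W(3)
    by (intro continuous_intros h.continuous_on contT) fastforce
  ultimately obtain x where x: "x \<in> ?S" and xmax: "\<And>y. y \<in> ?S \<Longrightarrow> R y \<le> R x"
    using continuous_attains_sup[of ?S R] by blast
  have xW: "x \<in> W" and x0: "x \<noteq> 0" using x by auto
  define z where "z = R x *\<^sub>R x - T x"
  have zW: "z \<in> W"
    unfolding z_def using xW TW W(1) by (simp add: subspace_diff subspace_scale)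
  define q where "q \<equiv> \<lambda>y. h (R x *\<^sub>R y - T y) y"
  have q0: "q y \<ge> 0" if y: "y \<in> W" for y
  proof (cases "y = 0")
    case False
    have "R ((1 / norm y) *\<^sub>R y) \<le> R x"
      using xmax[of "(1 / norm y) *\<^sub>R y"] False y W(1) by (simp add: subspace_scale)
    moreover have "R ((1 / norm y) *\<^sub>R y) = R y"
      using False by (simp add: R_def T.scale)
    ultimately have "h (T y) y \<le> R x * h y y"
      using W(3)[OF y False] by (simp add: R_def divide_le_eq)
    then show ?thesis by (simp add: q_def h.diff_left)
  qed (simp add: q_def h.zero_right)
  have qx: "q x = 0"
    using W(3)[OF xW x0] by (simp add: q_def h.diff_left R_def)
  have expand: "q (x + t *\<^sub>R z) = 2 * t * h z z + t\<^sup>2 * q z" for t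
  proof -
    have "q (x + t *\<^sub>R z) = q x + t * (h (R x *\<^sub>R x - T x) z + h (R x *\<^sub>R z - T z) x) + t\<^sup>2 * q z"
      by (simp add: q_def T.add T.scale h.add_left h.add_right h.diff_left
          algebra_simps power2_eq_square)
    moreover have "h (R x *\<^sub>R z - T z) x = h z z"
      using sa[OF zW xW] W(2)[OF zW xW] by (simp add: z_def h.diff_left h.diff_right)
    ultimately show ?thesis
      using qx by (simp flip: z_def)
  qed
  have "z = 0"
  proof (rule ccontr)
    assume "z \<noteq> 0"
    then have hz: "h z z > 0" using W(3) zW by blast
    \<comment> \<open>A small step from \<open>x\<close> against \<open>z\<close> makes
      \<open>q\<close> negative unless \<open>z = 0\<close>. This \<open>t\<close> turns
      \<open>2 * t * h z z + t\<^sup>2 * q z\<close> into \<open>- t\<^sup>2 * (q z + 2)\<close>;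
      the 1 in the denominator covers the case \<open>q z = 0\<close>.\<close>
    define t where "t = - (h z z / (q z + 1))"
    have qz: "q z \<ge> 0" using q0 zW by blast
    have "2 * t * h z z + t\<^sup>2 * q z \<ge> 0"
      using q0[of "x + t *\<^sub>R z"] xW zW W(1) by (simp add: expand subspace_add subspace_scale)
    moreover have hzt: "h z z = - t * (q z + 1)"
      using qz unfolding t_def by simp
    have "2 * t * h z z + t\<^sup>2 * q z = - (t\<^sup>2 * (q z + 2))"
      by (subst hzt) (simp add: algebra_simps power2_eq_square)
    moreover have "t \<noteq> 0" using hz hzt by auto
    then have "t\<^sup>2 * (q z + 2) > 0"
      using qz by (intro mult_pos_pos) auto
    ultimately show False by linarith
  qed
  then have Tx: "T x = R x *\<^sub>R x" by (simp add: z_def)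
  show thesis
  proof (rule that)
    show "(1 / sqrt (h x x)) *\<^sub>R x \<in> W"
      using xW W(1) by (simp add: subspace_scale)
    show "h ((1 / sqrt (h x x)) *\<^sub>R x) ((1 / sqrt (h x x)) *\<^sub>R x) = 1"
      using W(3)[OF xW x0] by simp
    show "T ((1 / sqrt (h x x)) *\<^sub>R x) = R x *\<^sub>R ((1 / sqrt (h x x)) *\<^sub>R x)"
      by (simp add: T.scale Tx)
  qed
qed

text \<open>Self-adjointness makes the \<open>h\<close>-orthogonal complement of an eigenvector
  inside \<open>W\<close> invariant again, so one eigenvector is split off and the dimension
  drops.\<close>

theorem self_adjoint_eigenbasis:
  fixes W :: "'v::euclidean_space set"
  assumes "inner_product_on W h" and "bilinear h" and "linear T"
    and "\<And>x. x \<in> W \<Longrightarrow> T x \<in> W"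
    and "\<And>x y. x \<in> W \<Longrightarrow> y \<in> W \<Longrightarrow> h (T x) y = h x (T y)"
  shows "\<exists>B. orthonormal_basis W h B \<and> (\<forall>b\<in>B. T b = h (T b) b *\<^sub>R b)"
  using assms
proof (induction "dim W" arbitrary: W rule: less_induct)
  case less
  note ip = less.prems(1) and bil = less.prems(2) and TW = less.prems(4) and sa = less.prems(5)
  note W = inner_product_onD[OF ip]
  have bb: "bounded_bilinear h"
    using bil by (simp add: bilinear_conv_bounded_bilinear)
  interpret h: bounded_bilinear h by (fact bb)
  show ?case
  proof (cases "W = {0}")
    case True
    then show ?thesis
      by (intro exI[of _ "{}"]) (simp add: orthonormal_basis_def)
  next
    case False
    obtain b c where b: "b \<in> W" "h b b = 1" "T b = c *\<^sub>R b"
      using self_adjoint_eigenvector[OF less.prems(1-5) False] by blast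
    define W' where "W' = {w \<in> W. h b w = 0}"
    have sub: "subspace W'" "W' \<subseteq> W"
      using W(1) by (auto simp: W'_def subspace_def h.zero_right h.add_right h.scaleR_right)
    have "b \<notin> W'" using b by (simp add: W'_def)
    then have "dim W' < dim W"
      using sub W(1) b(1) by (intro dim_psubset) (auto simp: span_eq_iff[THEN iffD2])
    moreover have "T w \<in> W'" if "w \<in> W'" for w
      using that TW sa[OF b(1), of w] b(3) by (simp add: W'_def h.scaleR_left)
    ultimately obtain B where B: "orthonormal_basis W' h B" "\<forall>b\<in>B. T b = h (T b) b *\<^sub>R b"
      using less.hyps[of W'] inner_product_on_subspace[OF ip sub] less.prems sub by blast
    have BW: "B \<subseteq> W'" and fB: "finite B" and sB: "span B = W'"
      using B(1) by (auto simp: orthonormal_basis_def)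
    have "W \<subseteq> span (insert b B)"
    proof
      fix w assume w: "w \<in> W"
      have "w - h b w *\<^sub>R b \<in> W'"
        using w b W(1) by (simp add: W'_def subspace_diff subspace_scale h.diff_right h.scaleR_right)
      then have "w - h b w *\<^sub>R b \<in> span B" using sB by simp
      then show "w \<in> span (insert b B)" by (auto simp: span_insert)
    qed
    moreover have "span (insert b B) \<subseteq> W"
      using b BW sub W(1) by (intro span_minimal) auto
    moreover have "h b x = 0" "h x b = 0" if "x \<in> B" for x
      using that BW W(2)[OF b(1), of x] by (auto simp: W'_def)
    ultimately have "orthonormal_basis W h (insert b B)"
      using B(1) b BW \<open>b \<notin> W'\<close> sub unfolding orthonormal_basis_def by auto
    moreover have "T b = h (T b) b *\<^sub>R b"
      using b by (simp add: h.scaleR_left)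
    ultimately show ?thesis using B(2) by blast
  qed
qed

corollary orthonormal_basis_exists:
  assumes "inner_product_on W h" and "bilinear h"
  shows "\<exists>B. orthonormal_basis W h B"
  using self_adjoint_eigenbasis[OF assms linear_id] by auto

lemma orthonormal_basis_expand:
  assumes B: "orthonormal_basis W h B" and bil: "bilinear h" and w: "w \<in> W"
  shows "w = (\<Sum>b\<in>B. h b w *\<^sub>R b)"
proof -
  note h = bil[unfolded bilinear_def]
  have fin: "finite B" and on: "\<And>b b'. b \<in> B \<Longrightarrow> b' \<in> B \<Longrightarrow> h b b' = (if b = b' then 1 else 0)"
    using B by (auto simp: orthonormal_basis_def)
  obtain c where c: "w = (\<Sum>b\<in>B. c b *\<^sub>R b)"
    using B w span_finite[OF fin] unfolding orthonormal_basis_def by blast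
  have "h b w = c b" if "b \<in> B" for b
  proof -
    have "h b w = (\<Sum>b'\<in>B. c b' * h b b')"
      using h by (simp add: c linear_sum linear_cmul)
    also have "\<dots> = (\<Sum>b'\<in>B. if b = b' then c b' else 0)"
      using that by (intro sum.cong) (auto simp: on)
    finally show ?thesis using that fin by simp
  qed
  then show ?thesis using c by simp
qed

section \<open>The operators \<open>Q(A)\<close> and \<open>S\<^sub>r(A)\<close>\<close>

text \<open>The sum satisfies the equation that describes the adjoint, and definiteness of
  \<open>g\<close> makes it the only solution, so the definite description is justified. The
  explicit formula also shows linearity in \<open>w\<close>.\<close>

lemma adjoint_map_expand:
  assumes B: "orthonormal_basis UNIV g B" and g: "inner_product_on UNIV g"
    and h: "bilinear h" and A: "linear A"
  shows "adjoint_map g h A w = (\<Sum>b\<in>B. h w (A b) *\<^sub>R b)" (is "_ = ?s")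
    and "g (adjoint_map g h A w) v = h w (A v)"
proof -
  note bil = inner_product_on_UNIV_bilinear[OF g]
  note bl = bil[unfolded bilinear_def] h[unfolded bilinear_def]
  have s: "g ?s v = h w (A v)" for v
  proof -
    have "g ?s v = (\<Sum>b\<in>B. h w (A b) * g b v)"
      using linear_sum[of "\<lambda>x. g x v" "\<lambda>b. h w (A b) *\<^sub>R b" B] bl
      by (simp add: linear_cmul[of "\<lambda>x. g x v"])
    also have "\<dots> = h w (A (\<Sum>b\<in>B. g b v *\<^sub>R b))"
      using bl A by (simp add: linear_sum linear_cmul mult.commute)
    finally show ?thesis
      using orthonormal_basis_expand[OF B bil, of v] by simp
  qed
  have uniq: "x = ?s" if x: "\<forall>v. g x v = h w (A v)" for x
  proof (rule ccontr)
    assume "x \<noteq> ?s"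
    then have "g (x - ?s) (x - ?s) > 0"
      using inner_product_onD(3)[OF g] by simp
    moreover have "g (x - ?s) v = 0" for v
      using linear_diff[of "\<lambda>x. g x v"] bl x s by simp
    ultimately show False by simp
  qed
  show eq: "adjoint_map g h A w = ?s"
    unfolding adjoint_map_def using s uniq by (intro the_equality) blast+
  show "g (adjoint_map g h A w) v = h w (A v)"
    using s eq by simp
qed

text \<open>The form \<open>h\<close> is bilinear on the whole ambient space but definite only on
  \<open>W\<close>; the case in view is the Minkowski form with a tangent space of the hyperboloid
  as \<open>W\<close>.\<close>

locale inner_product_map =
  fixes g :: "'n::euclidean_space \<Rightarrow> 'n \<Rightarrow> real" and W :: "'v::euclidean_space set"
    and h :: "'v \<Rightarrow> 'v \<Rightarrow> real" and A :: "'n \<Rightarrow> 'v"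
  assumes g: "inner_product_on UNIV g" and W: "inner_product_on W h" and h: "bilinear h"
    and A: "linear A" and AW: "range A \<subseteq> W"
begin

abbreviation "At \<equiv> adjoint_map g h A"
abbreviation "T \<equiv> A \<circ> At"

lemma source_basis:
  obtains B where "orthonormal_basis UNIV g B"
  using orthonormal_basis_exists[OF g inner_product_on_UNIV_bilinear[OF g]] by blast

lemma adjoint: "g (At w) v = h w (A v)"
  using source_basis adjoint_map_expand(2)[OF _ g h A] by metis

lemma linear_adjoint: "linear At"
proof -
  obtain B where B: "orthonormal_basis UNIV g B" by (rule source_basis)
  have "linear (\<lambda>w. \<Sum>b\<in>B. h w (A b) *\<^sub>R b)"
    by (intro linear_compose_sum ballI linearI)
      (simp_all add: bilinear_ladd[OF h] bilinear_lmul[OF h] scaleR_add_left)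
  then show ?thesis
    using adjoint_map_expand(1)[OF B g h A] by presburger
qed

lemma eigenbasis_T:
  "\<exists>B. orthonormal_basis W h B \<and> (\<forall>b\<in>B. T b = h (T b) b *\<^sub>R b)"
proof (rule self_adjoint_eigenbasis[OF W h])
  show "linear T" using A linear_adjoint by (simp add: linear_compose)
  show TW: "T x \<in> W" for x using AW by auto
  show "h (T x) y = h x (T y)" if "x \<in> W" "y \<in> W" for x y
  proof -
    have "h (T x) y = h y (A (At x))"
      using inner_product_onD(2)[OF W TW \<open>y \<in> W\<close>] by simp
    also have "\<dots> = g (At x) (At y)"
      using inner_product_onD(2)[OF g] adjoint by (metis UNIV_I)
    finally show ?thesis by (simp add: adjoint)
  qed
qed

text \<open>Nonnegative eigenvalues make \<open>powr (1/2)\<close> a true square root, so that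
  \<open>Q(A)\<close> squares to \<open>A A\<^sup>T\<close>.\<close>

lemma T_psd:
  assumes "b \<in> W"
  shows "h (T b) b \<ge> 0"
proof -
  have "h (T b) b = g (At b) (At b)"
    using inner_product_onD(2)[OF W _ assms, of "T b"] AW adjoint by auto
  moreover have "g 0 0 = 0"
    using inner_product_on_UNIV_bilinear[OF g] by (simp add: bilinear_lzero)
  ultimately show ?thesis
    using inner_product_onD(3)[OF g, of "At b"] by (cases "At b = 0") auto
qed

text \<open>The eigenbasis \<open>B\<close> chosen in \<open>S_op\<close> diagonalises \<open>Q(A)\<close>, hence also \<open>Q(A)\<^sup>2 = A A\<^sup>T\<close>.\<close>

lemma S_op_expand:
  obtains B c where "orthonormal_basis W h B"
    and "\<And>b. b \<in> B \<Longrightarrow> \<exists>l. T b = l *\<^sub>R b"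
    and "\<And>v. S_op g W h r A v = (\<Sum>b\<in>B. (c b * h b (A v)) *\<^sub>R b)"
proof -
  define C where "C = (SOME B. orthonormal_basis W h B \<and> (\<forall>b\<in>B. T b = h (T b) b *\<^sub>R b))"
  have C: "orthonormal_basis W h C" "\<And>b. b \<in> C \<Longrightarrow> T b = h (T b) b *\<^sub>R b"
    using someI_ex[OF eigenbasis_T] unfolding C_def by blast+
  have CW: "C \<subseteq> W" and fC: "finite C"
    and on: "\<And>b b'. b \<in> C \<Longrightarrow> b' \<in> C \<Longrightarrow> h b b' = (if b = b' then 1 else 0)"
    using C(1) by (auto simp: orthonormal_basis_def)
  define Q where "Q = Q_op g W h A"
  have Q: "Q w = (\<Sum>b\<in>C. (h (T b) b powr (1/2) * h b w) *\<^sub>R b)" for w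
    unfolding Q_def Q_op_def psd_powr_def Let_def C_def ..
  have linQ: "linear Q"
    unfolding Q
    by (intro linear_compose_sum ballI linearI)
      (simp_all add: bilinear_radd[OF h] bilinear_rmul[OF h] algebra_simps)
  have QC: "Q b = sqrt (h (T b) b) *\<^sub>R b" if b: "b \<in> C" for b
  proof -
    have "Q b = (\<Sum>b'\<in>C. if b' = b then sqrt (h (T b) b) *\<^sub>R b else 0)"
      unfolding Q using b T_psd CW
      by (intro sum.cong) (auto simp: on powr_half_sqrt simp del: o_apply)
    then show ?thesis using b fC by simp
  qed
  have linT: "linear T"
    using A linear_adjoint by (simp add: linear_compose)
  \<comment> \<open>Both sides are linear, so the identity is checked on \<open>C\<close>, which
    spans \<open>W\<close>.\<close>
  have Q2: "Q (Q w) = T w" if w: "w \<in> W" for w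
  proof (rule linear_eq_on[of "Q \<circ> Q" T w C, unfolded o_apply[of Q Q]])
    show "w \<in> span C" using C(1) w by (simp add: orthonormal_basis_def)
    show "Q (Q b) = T b" if b: "b \<in> C" for b
    proof -
      have "Q (Q b) = h (T b) b *\<^sub>R b"
        using QC[OF b] T_psd[of b] b CW linQ by (auto simp: linear_cmul)
      then show ?thesis using C(2)[OF b] by simp
    qed
  qed (use linT linear_compose[OF linQ linQ, unfolded o_def] in auto)
  \<comment> \<open>The choice inside \<open>S_op\<close> is made for \<open>Q\<close> and need not
    return \<open>C\<close>; \<open>C\<close> only witnesses that an eigenbasis of \<open>Q\<close>
    exists.\<close>
  define B where "B = (SOME B. orthonormal_basis W h B \<and> (\<forall>b\<in>B. Q b = h (Q b) b *\<^sub>R b))"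
  have "Q b = h (Q b) b *\<^sub>R b" if "b \<in> C" for b
    using QC[OF that] on[OF that that] h by (simp add: bilinear_lmul)
  then have ex: "\<exists>B. orthonormal_basis W h B \<and> (\<forall>b\<in>B. Q b = h (Q b) b *\<^sub>R b)"
    using C(1) by blast
  have B: "orthonormal_basis W h B" "\<And>b. b \<in> B \<Longrightarrow> Q b = h (Q b) b *\<^sub>R b"
    using someI_ex[OF ex] unfolding B_def by blast+
  have BW: "B \<subseteq> W" using B(1) by (simp add: orthonormal_basis_def)
  have "T b = (h (Q b) b * h (Q b) b) *\<^sub>R b" if b: "b \<in> B" for b
  proof -
    define l where "l = h (Q b) b"
    have Qb: "Q b = l *\<^sub>R b" using B(2)[OF b] by (simp add: l_def)
    have "T b = Q (Q b)" using Q2[of b] b BW by auto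
    also have "\<dots> = (l * l) *\<^sub>R b" by (simp add: Qb linear_cmul[OF linQ])
    finally show ?thesis by (simp add: l_def)
  qed
  moreover have "S_op g W h r A v = (\<Sum>b\<in>B. (h (Q b) b powr (r - 1) * h b (A v)) *\<^sub>R b)" for v
    unfolding S_op_def psd_powr_def Let_def Q_def[symmetric] B_def by simp
  ultimately show thesis using that[of B "\<lambda>b. h (Q b) b powr (r - 1)"] B(1) by blast
qed

text \<open>For the tangent space this is what allows the normal part of a derivative to be
  discarded when it is paired with \<open>S\<^sub>r(A)\<close>.\<close>

lemma S_op_range: "S_op g W h r A v \<in> W"
proof -
  obtain B c where B: "orthonormal_basis W h B"
    and S: "\<And>v. S_op g W h r A v = (\<Sum>b\<in>B. (c b * h b (A v)) *\<^sub>R b)"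
    by (rule S_op_expand) blast
  then show ?thesis
    using inner_product_onD(1)[OF W] unfolding S orthonormal_basis_def
    by (intro subspace_sum subspace_scale) auto
qed

text \<open>In an eigenbasis \<open>\<beta>\<close> of \<open>A A\<^sup>T\<close> the pairing is a combination of the numbers
  \<open>h(\<beta>, P A A\<^sup>T \<beta>)\<close>, which are multiples of \<open>h(\<beta>, P \<beta>)\<close>.\<close>

lemma form_pairing_S_op_skew:
  assumes P: "linear P" and skew: "\<And>w. h w (P w) = 0"
  shows "form_pairing g h (S_op g W h r A) (\<lambda>v. P (A v)) = 0"
proof -
  define B0 where "B0 = (SOME B. orthonormal_basis UNIV g B)"
  have B0: "orthonormal_basis UNIV g B0"
    unfolding B0_def using source_basis by (metis someI_ex)
  obtain B c where "orthonormal_basis W h B" and B: "\<And>b. b \<in> B \<Longrightarrow> \<exists>l. T b = l *\<^sub>R b"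
    and S: "\<And>v. S_op g W h r A v = (\<Sum>b\<in>B. (c b * h b (A v)) *\<^sub>R b)"
    by (rule S_op_expand[where r = r]) (rule that; assumption)
  interpret h: bounded_bilinear h
    using h by (simp add: bilinear_conv_bounded_bilinear)
  interpret PA: linear "\<lambda>v. P (A v)"
    using linear_compose[OF A P] by (simp add: o_def)
  interpret P: linear P by (fact P)
  have "form_pairing g h (S_op g W h r A) (\<lambda>v. P (A v))
      = (\<Sum>v\<in>B0. \<Sum>b\<in>B. c b * (h b (A v) * h b (P (A v))))"
    unfolding form_pairing_def B0_def[symmetric] S
    by (simp add: h.sum_left h.scaleR_left mult.assoc)
  also have "\<dots> = (\<Sum>b\<in>B. c b * (\<Sum>v\<in>B0. h b (A v) * h b (P (A v))))"
    by (subst sum.swap) (simp add: sum_distrib_left)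
  \<comment> \<open>Summing \<open>h b (A v) *\<^sub>R v\<close> over \<open>B0\<close> reassembles
    \<open>At b\<close>.\<close>
  also have "\<dots> = (\<Sum>b\<in>B. c b * h b (P (A (At b))))"
    by (simp add: adjoint_map_expand(1)[OF B0 g h A] PA.sum PA.scale h.sum_right h.scaleR_right)
  also have "\<dots> = 0"
  proof (intro sum.neutral ballI)
    fix b assume "b \<in> B"
    then obtain l where "A (At b) = l *\<^sub>R b" using B by auto
    then show "c b * h b (P (A (At b))) = 0"
      using skew by (simp add: P.scale h.scaleR_right)
  qed
  finally show ?thesis .
qed

end

section \<open>The Minkowski form\<close>

lemma sum_UNIV_option: "(\<Sum>i\<in>UNIV. f i) = f None + (\<Sum>i\<in>UNIV. f (Some i))"
  for f :: "'m::finite option \<Rightarrow> 'b::comm_monoid_add"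
  by (simp add: UNIV_option_conv sum.reindex)

lemma e_sharp_mult_vec: "(e_sharp *v X) $ i = (if i = None then - X $ i else X $ i)"
proof -
  have "(e_sharp *v X) $ i = (\<Sum>j\<in>UNIV. if i = j then (if i = None then - X $ i else X $ i) else 0)"
    unfolding matrix_vector_mult_def e_sharp_def vec_lambda_beta by (intro sum.cong) auto
  then show ?thesis by simp
qed

lemma mink_eq_inner: "mink X Y = X \<bullet> (e_sharp *v Y)"
  unfolding mink_def inner_vec_def by (simp add: sum_UNIV_option e_sharp_mult_vec)

lemma transpose_e_sharp [simp]: "transpose e_sharp = e_sharp"
  by (simp add: transpose_def e_sharp_def vec_eq_iff)

lemma e_sharp_e_sharp_vec [simp]: "e_sharp *v (e_sharp *v X) = X"
  by (simp add: vec_eq_iff e_sharp_mult_vec)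

lemma e_sharp_e_sharp [simp]: "e_sharp ** e_sharp = mat 1"
  by (simp add: matrix_eq flip: matrix_vector_mul_assoc)

lemma mink_commute: "mink X Y = mink Y X"
  by (simp add: mink_def mult.commute)

lemma bilinear_mink: "bilinear mink"
  unfolding bilinear_def mink_eq_inner
  by (intro conjI allI linearI)
    (simp_all add: inner_add matrix_vector_right_distrib inner_commute matrix_vector_mult_scaleR)

interpretation mink: bounded_bilinear mink
  using bilinear_mink by (simp add: bilinear_conv_bounded_bilinear)

text \<open>Let \<open>U\<close> and \<open>V\<close> be the squared lengths of the spacelike parts
  of \<open>X\<close> and \<open>v\<close>. If \<open>v\<close> is orthogonal to \<open>X\<close>
  and not spacelike, Cauchy-Schwarz gives \<open>(v $ None)\<^sup>2 * (1 + U) \<le> V * U \<le> (v $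
  None)\<^sup>2 * U\<close>. Hence \<open>v $ None = 0\<close>, and then
  \<open>V = 0\<close>.\<close>

lemma inner_product_on_tangent_hyperboloid:
  assumes X: "X \<in> hyperboloid"
  shows "inner_product_on (tangent_hyperboloid X) mink"
proof -
  have pos: "mink v v > 0" if v: "mink v X = 0" and nz: "v \<noteq> 0" for v
  proof (rule ccontr)
    assume "\<not> mink v v > 0"
    define V where "V = (\<Sum>i\<in>UNIV. (v $ Some i)\<^sup>2)"
    define U where "U = (\<Sum>i\<in>UNIV. (X $ Some i)\<^sup>2)"
    have V: "V \<le> (v $ None)\<^sup>2"
      using \<open>\<not> mink v v > 0\<close> by (simp add: mink_def V_def power2_eq_square)
    have U: "(X $ None)\<^sup>2 = 1 + U"
      using X by (simp add: hyperboloid_def mink_def U_def power2_eq_square)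
    have V0: "V \<ge> 0" and U0: "U \<ge> 0"
      by (simp_all add: V_def U_def sum_nonneg)
    have "(\<Sum>i\<in>UNIV. v $ Some i * X $ Some i) = v $ None * X $ None"
      using v by (simp add: mink_def)
    moreover have "(\<Sum>i\<in>UNIV. v $ Some i * X $ Some i)\<^sup>2 \<le> V * U"
      unfolding V_def U_def by (rule Cauchy_Schwarz_ineq_sum)
    ultimately have "(v $ None)\<^sup>2 * (1 + U) \<le> V * U"
      by (simp add: power_mult_distrib U)
    also have "\<dots> \<le> (v $ None)\<^sup>2 * U"
      using V U0 by (rule mult_right_mono)
    finally have n: "v $ None = 0"
      by (simp add: algebra_simps)
    then have "V = 0" using V V0 by simp
    then have "v $ Some i = 0" for i
      by (simp add: V_def sum_nonneg_eq_0_iff)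
    with n have "v = 0"
      by (metis (mono_tags, lifting) not_None_eq vec_eq_iff zero_index)
    then show False using nz by simp
  qed
  have "subspace (tangent_hyperboloid X)"
    by (simp add: subspace_def tangent_hyperboloid_def mink.zero_left mink.add_left mink.scaleR_left)
  then show ?thesis
    unfolding inner_product_on_def using pos
    by (auto simp: tangent_hyperboloid_def mink.add_left mink.scaleR_left intro: mink_commute)
qed

text \<open>The adjoint with respect to \<open>mink\<close>. It characterises so(m,1) as the
  matrices with \<open>mink_adjoint F = - F\<close>, and on \<open>SO_plus\<close> it is the
  inverse.\<close>

definition mink_adjoint :: "('m::finite) mink_mat \<Rightarrow> 'm mink_mat" where
  "mink_adjoint F = e_sharp ** transpose F ** e_sharp"

lemma mink_mult_right: "mink X (F *v Y) = mink (mink_adjoint F *v X) Y"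
proof -
  have "mink (mink_adjoint F *v X) Y = (e_sharp *v Y) \<bullet> (e_sharp *v (transpose F *v (e_sharp *v X)))"
    by (simp add: mink_eq_inner mink_adjoint_def inner_commute flip: matrix_vector_mul_assoc)
  also have "\<dots> = Y \<bullet> (transpose F *v (e_sharp *v X))"
    by (metis dot_lmul_matrix e_sharp_e_sharp_vec transpose_e_sharp transpose_matrix_vector)
  also have "\<dots> = mink (F *v Y) X"
    by (metis dot_lmul_matrix mink_eq_inner transpose_matrix_vector transpose_transpose)
  finally show ?thesis by (simp add: mink_commute)
qed

lemma mink_adjoint_mink_adjoint [simp]: "mink_adjoint (mink_adjoint F) = F"
  by (simp add: mink_adjoint_def matrix_transpose_mul matrix_mul_assoc flip: matrix_mul_assoc[of _ e_sharp e_sharp])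

lemma mink_adjoint_mult: "mink_adjoint (F ** G) = mink_adjoint G ** mink_adjoint F"
proof -
  have "mink_adjoint G ** mink_adjoint F
      = e_sharp ** transpose G ** (e_sharp ** e_sharp) ** transpose F ** e_sharp"
    by (simp only: mink_adjoint_def matrix_mul_assoc)
  then show ?thesis
    by (simp add: mink_adjoint_def matrix_transpose_mul matrix_mul_assoc)
qed

text \<open>The cross product is a difference of two rank-one matrices, and the trace of
  \<open>Y X\<^sup>\<sharp> F\<close> is the number \<open>X\<^sup>\<sharp> F Y\<close>. The second
  term is brought to the same shape by the adjoint.\<close>

lemma trace_mink_cross:
  "trace (mink_cross X Y ** F) = mink X ((F - mink_adjoint F) *v Y)"
proof -
  have tr: "(\<Sum>i\<in>UNIV. \<Sum>j\<in>UNIV. P $ i * (e_sharp *v R) $ j * F $ j $ i) = mink R (F *v P)"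
    for P R
  proof -
    have "mink R (F *v P) = (\<Sum>j\<in>UNIV. (F *v P) $ j * (e_sharp *v R) $ j)"
      by (subst mink_commute) (simp add: mink_eq_inner inner_vec_def)
    also have "\<dots> = (\<Sum>j\<in>UNIV. \<Sum>i\<in>UNIV. P $ i * (e_sharp *v R) $ j * F $ j $ i)"
      unfolding matrix_vector_mult_def[of F] by (simp add: sum_distrib_right sum_distrib_left mult_ac)
    finally show ?thesis by (subst sum.swap) simp
  qed
  have "trace (mink_cross X Y ** F) = (\<Sum>i\<in>UNIV. \<Sum>j\<in>UNIV.
      Y $ i * (e_sharp *v X) $ j * F $ j $ i - X $ i * (e_sharp *v Y) $ j * F $ j $ i)"
    by (simp add: trace_def matrix_matrix_mult_def mink_cross_def left_diff_distrib)
  also have "\<dots> = mink X (F *v Y) - mink Y (F *v X)"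
    by (simp only: sum_subtractf tr)
  also have "mink Y (F *v X) = mink X (mink_adjoint F *v Y)"
    using mink_mult_right[of X "mink_adjoint F" Y] by (simp add: mink_commute[of Y])
  finally show ?thesis
    by (simp add: matrix_vector_mult_diff_rdistrib mink.diff_right)
qed

text \<open>The linear projection onto so(m,1). Being linear, it commutes with differentiation;
  being a projection, it reproduces matrices that are already skew.\<close>

definition skew_part :: "('m::finite) mink_mat \<Rightarrow> 'm mink_mat" where
  "skew_part F = (1/2) *\<^sub>R (F - mink_adjoint F)"

text \<open>Against a cross product the trace form sees only the skew part of \<open>F\<close>; the
  2 undoes the normalisation of the projection.\<close>

lemma trace_mink_cross_skew_part:
  "trace (mink_cross X Y ** F) = 2 * mink X (skew_part F *v Y)"
  by (simp add: trace_mink_cross skew_part_def mink.scaleR_right flip: scaleR_matrix_vector_assoc)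

lemma mink_skew_part: "mink (skew_part F *v X) X = 0"
proof -
  have "mink X (F *v X) = mink X (mink_adjoint F *v X)"
    by (simp add: mink_mult_right[of _ F] mink_commute)
  then show ?thesis
    by (simp add: mink_commute[of _ X] skew_part_def mink.scaleR_right mink.diff_right
        matrix_vector_mult_diff_rdistrib flip: scaleR_matrix_vector_assoc)
qed

lemma so_mink_iff: "F \<in> so_mink \<longleftrightarrow> mink_adjoint F = - F"
proof
  assume "F \<in> so_mink"
  then have "e_sharp ** (transpose F ** e_sharp) = - (e_sharp ** (e_sharp ** F))"
    by (simp add: so_mink_def eq_neg_iff_add_eq_0 flip: matrix_add_ldistrib)
  then show "mink_adjoint F = - F"
    by (simp add: mink_adjoint_def matrix_mul_assoc)
next
  assume "mink_adjoint F = - F"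
  then have "e_sharp ** mink_adjoint F + e_sharp ** F = 0"
    by (simp flip: matrix_add_ldistrib)
  then show "F \<in> so_mink"
    by (simp add: so_mink_def mink_adjoint_def matrix_mul_assoc)
qed

lemma skew_part_so_mink: "F \<in> so_mink \<Longrightarrow> skew_part F = F"
  by (simp add: so_mink_iff skew_part_def flip: scaleR_2)

lemma linear_mink_adjoint: "linear mink_adjoint"
  by (intro linearI) (simp_all add: mink_adjoint_def vec_eq_iff matrix_matrix_mult_def transpose_def
      sum_distrib_left sum_distrib_right sum.distrib algebra_simps)

lemma linear_skew_part: "linear skew_part"
  by (intro linearI) (simp_all add: skew_part_def linear_add[OF linear_mink_adjoint]
      linear_cmul[OF linear_mink_adjoint] algebra_simps)

lemma so_mink_mink_self: 
  assumes "F \<in> so_mink"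
  shows "mink X (F *v X) = 0"
  using mink_skew_part[of F X] skew_part_so_mink[OF assms] by (simp add: mink_commute)

section \<open>Isometries and their adjoint action\<close>

lemma SO_plus_mink_adjoint:
  assumes "R \<in> SO_plus"
  shows "matrix_inv R = mink_adjoint R" "mink_adjoint R ** R = mat 1" "R ** mink_adjoint R = mat 1"
proof -
  have "e_sharp ** (transpose R ** e_sharp ** R) = mat 1"
    using assms by (simp add: SO_plus_def)
  then show 1: "mink_adjoint R ** R = mat 1"
    by (simp add: mink_adjoint_def matrix_mul_assoc)
  then show 2: "R ** mink_adjoint R = mat 1"
    by (simp add: matrix_left_right_inverse)
  show "matrix_inv R = mink_adjoint R"
  proof -
    have "R ** matrix_inv R = mat 1 \<and> matrix_inv R ** R = mat 1"
      unfolding matrix_inv_def using 1 2 by (metis (mono_tags, lifting) someI)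
    then have "matrix_inv R ** (R ** mink_adjoint R) = mink_adjoint R"
      by (simp add: matrix_mul_assoc)
    then show ?thesis by (simp add: 2)
  qed
qed

text \<open>Conjugation by an isometry commutes with the Minkowski adjoint. This keeps forms built
  from skew parts equivariant.\<close>

lemma skew_part_adjoint_action:
  assumes "R \<in> SO_plus"
  shows "skew_part (adjoint_action R F) = adjoint_action R (skew_part F)"
proof -
  have lin: "linear (\<lambda>F. R ** F ** mink_adjoint R)"
    by (intro linearI) (simp_all add: vec_eq_iff matrix_matrix_mult_def
      sum_distrib_left sum_distrib_right sum.distrib algebra_simps)
  have "mink_adjoint (R ** F ** mink_adjoint R) = R ** mink_adjoint F ** mink_adjoint R"
    by (simp add: mink_adjoint_mult matrix_mul_assoc)
  then show ?thesis
    using lin by (simp add: adjoint_action_def SO_plus_mink_adjoint[OF assms] skew_part_def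
        linear_cmul[OF lin] linear_diff[OF lin])
qed

lemma adjoint_action_mult_vec:
  assumes "R \<in> SO_plus"
  shows "adjoint_action R F *v (R *v X) = R *v (F *v X)"
proof -
  have "adjoint_action R F *v (R *v X) = (R ** F ** (mink_adjoint R ** R)) *v X"
    by (simp only: adjoint_action_def SO_plus_mink_adjoint(1)[OF assms] matrix_vector_mul_assoc matrix_mul_assoc)
  then show ?thesis
    by (simp add: SO_plus_mink_adjoint(2)[OF assms] matrix_vector_mul_assoc)
qed

section \<open>Functions of class \<open>C\<^sup>k\<close>\<close>

text \<open>Openness of \<open>T\<close> makes derivatives at its points depend only on values
  inside \<open>T\<close>. The closure rules for sums, products and linear images compute a
  derivative on \<open>T\<close> and transfer it through this.\<close>

lemma Ck_on_cong:
  assumes "open T" "Ck_on k T f" "\<And>x. x \<in> T \<Longrightarrow> f x = f' x"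
  shows "Ck_on k T f'"
  using assms(2,3)
proof (induction k arbitrary: f f')
  case 0
  then show ?case using continuous_on_cong by (metis Ck_on.simps(1))
next
  case (Suc k)
  have hd: "(f' has_derivative frechet_derivative f (at x)) (at x)" if "x \<in> T" for x
  proof -
    have "(f has_derivative frechet_derivative f (at x)) (at x)"
      using Suc.prems(1) that by (auto simp flip: frechet_derivative_works)
    then show ?thesis
      by (rule has_derivative_transform_within_open[OF _ assms(1) that]) (use Suc.prems(2) in auto)
  qed
  have "Ck_on k T (\<lambda>x. frechet_derivative f' (at x) v)" for v
    by (rule Suc.IH[of "\<lambda>x. frechet_derivative f (at x) v"])
      (use Suc.prems(1) in \<open>auto simp: frechet_derivative_at[OF hd, symmetric]\<close>)
  then show ?case using hd by (auto simp: differentiable_def)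
qed

lemma Ck_on_SucD: "Ck_on (Suc k) T f \<Longrightarrow> Ck_on k T f"
proof (induction k arbitrary: f)
  case 0
  then show ?case
    using differentiable_imp_continuous_within continuous_at_imp_continuous_on
    by (metis Ck_on.simps(1,2))
qed auto

lemma Ck_on_local:
  assumes "\<And>x. x \<in> T \<Longrightarrow> \<exists>U. open U \<and> x \<in> U \<and> Ck_on k U f"
  shows "Ck_on k T f"
  using assms
proof (induction k arbitrary: f)
  case 0
  then have "isCont f x" if "x \<in> T" for x
    using that continuous_on_eq_continuous_at by (metis Ck_on.simps(1))
  then show ?case by (simp add: continuous_at_imp_continuous_on)
next
  case (Suc k)
  have "Ck_on k T (\<lambda>x. frechet_derivative f (at x) v)" for v
    by (rule Suc.IH) (metis Suc.prems Ck_on.simps(2))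
  moreover have "f differentiable (at x)" if "x \<in> T" for x
    using Suc.prems that by (metis Ck_on.simps(2))
  ultimately show ?case by simp
qed

lemma Ck_on_subset: "Ck_on k T f \<Longrightarrow> S \<subseteq> T \<Longrightarrow> Ck_on k S f"
proof (induction k arbitrary: f)
  case 0
  then show ?case by (auto intro: continuous_on_subset)
qed auto

lemma Ck_on_0: "Ck_on k T (\<lambda>x. 0)"
  by (induction k) (simp_all add: frechet_derivative_const)

lemma Ck_on_add:
  assumes "open T" "Ck_on k T f" "Ck_on k T g"
  shows "Ck_on k T (\<lambda>x. f x + g x)"
  using assms(2,3)
proof (induction k arbitrary: f g)
  case 0
  then show ?case by (simp add: continuous_on_add)
next
  case (Suc k)
  have hd: "((\<lambda>x. f x + g x) has_derivative
      (\<lambda>v. frechet_derivative f (at x) v + frechet_derivative g (at x) v)) (at x)" if "x \<in> T" for x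
    using Suc.prems that
    by (intro has_derivative_add) (auto simp flip: frechet_derivative_works)
  have "Ck_on k T (\<lambda>x. frechet_derivative (\<lambda>x. f x + g x) (at x) v)" for v
  proof (rule Ck_on_cong[OF assms(1)])
    show "Ck_on k T (\<lambda>x. frechet_derivative f (at x) v + frechet_derivative g (at x) v)"
      by (rule Suc.IH) (use Suc.prems in auto)
  qed (simp add: frechet_derivative_at[OF hd, symmetric])
  then show ?case using hd by (auto simp: differentiable_def)
qed

lemma Ck_on_mult:
  fixes f g :: "'a::euclidean_space \<Rightarrow> real"
  assumes "open T" "Ck_on k T f" "Ck_on k T g"
  shows "Ck_on k T (\<lambda>x. f x * g x)"
  using assms(2,3)
proof (induction k arbitrary: f g)
  case 0
  then show ?case by (simp add: continuous_on_mult)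
next
  case (Suc k)
  have hd: "((\<lambda>x. f x * g x) has_derivative
      (\<lambda>v. f x * frechet_derivative g (at x) v + frechet_derivative f (at x) v * g x)) (at x)"
    if "x \<in> T" for x
    using Suc.prems that
    by (intro has_derivative_mult) (auto simp flip: frechet_derivative_works)
  have "Ck_on k T (\<lambda>x. frechet_derivative (\<lambda>x. f x * g x) (at x) v)" for v
  proof (rule Ck_on_cong[OF assms(1)])
    show "Ck_on k T (\<lambda>x. f x * frechet_derivative g (at x) v + frechet_derivative f (at x) v * g x)"
      \<comment> \<open>Each term of the product rule keeps one undifferentiated factor, so
        \<open>f\<close> and \<open>g\<close> themselves enter with order \<open>k\<close>.\<close>
      using Suc.prems Ck_on_SucD[OF Suc.prems(1)] Ck_on_SucD[OF Suc.prems(2)]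
      by (intro Ck_on_add[OF assms(1)] Suc.IH) auto
  qed (simp add: frechet_derivative_at[OF hd, symmetric])
  then show ?case using hd by (auto simp: differentiable_def)
qed

lemma Ck_on_bounded_linear:
  assumes L: "bounded_linear L" and "open T" "Ck_on k T f"
  shows "Ck_on k T (\<lambda>x. L (f x))"
  using assms(3)
proof (induction k arbitrary: f)
  case 0
  then show ?case by (simp add: bounded_linear.continuous_on[OF L])
next
  case (Suc k)
  have hd: "((\<lambda>x. L (f x)) has_derivative (\<lambda>v. L (frechet_derivative f (at x) v))) (at x)"
    if "x \<in> T" for x
    using Suc.prems that
    by (intro bounded_linear.has_derivative[OF L]) (auto simp flip: frechet_derivative_works)
  have "Ck_on k T (\<lambda>x. frechet_derivative (\<lambda>x. L (f x)) (at x) v)" for v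
  proof (rule Ck_on_cong[OF assms(2)])
    show "Ck_on k T (\<lambda>x. L (frechet_derivative f (at x) v))"
      by (rule Suc.IH) (use Suc.prems in auto)
  qed (simp add: frechet_derivative_at[OF hd, symmetric])
  then show ?case using hd by (auto simp: differentiable_def)
qed

text \<open>Near an interior point the local smooth extension coincides with \<open>f\<close> on a
  full neighbourhood.\<close>

lemma smooth_on_interior:
  assumes "smooth_on S f"
  shows "Ck_on k (interior S) f"
proof (rule Ck_on_local)
  fix x assume x: "x \<in> interior S"
  then obtain T F where T: "open T" "x \<in> T" "Ck_on k T F" "\<forall>y\<in>S \<inter> T. F y = f y"
    using assms interior_subset unfolding smooth_on_def by (metis in_mono)
  have "Ck_on k (interior S \<inter> T) f"
  proof (rule Ck_on_cong)
    show "Ck_on k (interior S \<inter> T) F" using T(3) by (rule Ck_on_subset) auto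
  qed (use T interior_subset in \<open>auto simp: open_Int\<close>)
  then show "\<exists>U. open U \<and> x \<in> U \<and> Ck_on k U f"
    using x T by (meson IntI open_Int open_interior)
qed

section \<open>Derivatives on relatively open subsets of half-spaces\<close>

text \<open>At a boundary point at least one of \<open>i\<close> and \<open>- i\<close> points into
  the half-space. This one-sided approach in every direction is the condition under which a
  derivative within \<open>S\<close> is unique.\<close>

lemma openin_halfspace_directions:
  fixes i :: "'a::euclidean_space"
  assumes S: "openin (top_of_set {y. 0 \<le> a \<bullet> y}) S" and x: "x \<in> S" and e: "e > 0"
  shows "\<exists>d. 0 < \<bar>d\<bar> \<and> \<bar>d\<bar> < e \<and> x + d *\<^sub>R i \<in> S"
proof -
  obtain U where U: "open U" "S = {y. 0 \<le> a \<bullet> y} \<inter> U"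
    using S by (auto simp: openin_open)
  then obtain r where r: "r > 0" "ball x r \<subseteq> U"
    using x open_contains_ball by blast
  \<comment> \<open>Adding 1 to \<open>norm i\<close> covers \<open>i = 0\<close>; halving
    \<open>q\<close> in the choice of \<open>d\<close> gives the strict inequalities.\<close>
  define q where "q = min e (r / (norm i + 1))"
  have q: "q > 0" "q \<le> e" "q * (norm i + 1) \<le> r"
  proof -
    show "q > 0" "q \<le> e" using e r by (simp_all add: q_def add_nonneg_pos)
    have "q \<le> r / (norm i + 1)" by (simp add: q_def)
    then show "q * (norm i + 1) \<le> r" by (simp add: pos_le_divide_eq add_nonneg_pos)
  qed
  define d where "d = (if a \<bullet> i \<ge> 0 then q / 2 else - q / 2)"
  have d: "0 < \<bar>d\<bar>" "\<bar>d\<bar> < e" "\<bar>d\<bar> = q / 2"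
    using q by (auto simp: d_def)
  have "\<bar>d\<bar> * norm i \<le> \<bar>d\<bar> * (norm i + 1)" by (simp add: mult_left_mono)
  also have "\<dots> < r" using q r by (simp add: d(3))
  finally have "x + d *\<^sub>R i \<in> ball x r" by (simp add: dist_norm)
  moreover have "d * (a \<bullet> i) \<ge> 0"
    using q by (auto simp: d_def mult_nonneg_nonpos)
  then have "0 \<le> a \<bullet> (x + d *\<^sub>R i)"
    using x U by (simp add: inner_add_right)
  ultimately show ?thesis using d(1,2) r(2) U(2) by blast
qed

lemma has_derivative_unique_halfspace:
  fixes f :: "'a::euclidean_space \<Rightarrow> 'b::real_normed_vector"
  assumes "openin (top_of_set {y. 0 \<le> a \<bullet> y}) S" "x \<in> S"
    and "(f has_derivative f') (at x within S)" "(f has_derivative f'') (at x within S)"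
  shows "f' = f''"
  using frechet_derivative_unique_within[OF assms(3,4)] openin_halfspace_directions[OF assms(1,2)]
  by blast

text \<open>Near each point \<open>f\<close> has a \<open>C\<^sup>1\<close> extension, and
  uniqueness of derivatives within the half-space identifies \<open>D\<close> with the derivative of
  that extension, also at boundary points.\<close>

lemma smooth_on_derivative_continuous:
  fixes S :: "'a::euclidean_space set"
  assumes S: "openin (top_of_set {y. 0 \<le> a \<bullet> y}) S" and sm: "smooth_on S f"
    and D: "\<And>y. y \<in> S \<Longrightarrow> (f has_derivative D y) (at y within S)"
  shows "continuous_on S (\<lambda>y. D y v)"
  unfolding continuous_on_eq_continuous_within
proof
  fix x assume x: "x \<in> S"
  then obtain T F where T: "open T" "x \<in> T" "Ck_on 1 T F" "\<forall>y\<in>S \<inter> T. F y = f y"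
    using sm unfolding smooth_on_def by metis
  have ST: "openin (top_of_set {y. 0 \<le> a \<bullet> y}) (S \<inter> T)"
    using S T(1) by (rule openin_Int_open)
  have "frechet_derivative F (at y) = D y" if y: "y \<in> S \<inter> T" for y
  proof (rule has_derivative_unique_halfspace[OF ST y])
    show "(F has_derivative frechet_derivative F (at y)) (at y within S \<inter> T)"
      using T(3) y by (auto simp flip: frechet_derivative_works intro: has_derivative_at_withinI)
    have "(f has_derivative D y) (at y within S \<inter> T)"
      using D y by (meson IntD1 has_derivative_subset inf_le1)
    then show "(F has_derivative D y) (at y within S \<inter> T)"
      by (rule has_derivative_transform[rotated 2]) (use y T(4) in auto)
  qed
  moreover have "continuous_on (S \<inter> T) (\<lambda>y. frechet_derivative F (at y) v)"
    using T(3) by (auto intro: continuous_on_subset)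
  ultimately have "continuous_on (S \<inter> T) (\<lambda>y. D y v)"
    by (metis (mono_tags, lifting) continuous_on_cong)
  then have "continuous (at x within S \<inter> T) (\<lambda>y. D y v)"
    using x T(2) by (simp add: continuous_on_eq_continuous_within)
  moreover have "at x within S = at x within S \<inter> T"
    using T(1,2) by (intro at_within_nhd[of x T]) auto
  ultimately show "continuous (at x within S) (\<lambda>y. D y v)" by simp
qed

section \<open>Products in Sobolev spaces\<close>

lemma compact_continuous_bound:
  fixes f :: "'a::topological_space \<Rightarrow> 'b::real_normed_vector"
  assumes "compact K" "continuous_on K f"
  obtains C where "C > 0" "\<And>x. x \<in> K \<Longrightarrow> norm (f x) \<le> C"
  using compact_imp_bounded[OF compact_continuous_image[OF assms(2,1)]]
  by (auto simp: bounded_pos)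

lemma set_borel_measurable_continuous:
  fixes f :: "'a::euclidean_space \<Rightarrow> 'b::real_normed_vector"
  assumes "compact K" "continuous_on K f"
  shows "set_borel_measurable lborel K f"
  using assms borel_measurable_continuous_on_indicator[of K f]
  by (simp add: set_borel_measurable_def borel_compact)

lemma set_borel_measurable_bilinear:
  fixes f :: "'x \<Rightarrow> 'a::euclidean_space" and g :: "'x \<Rightarrow> 'b::euclidean_space"
    and B :: "'a \<Rightarrow> 'b \<Rightarrow> 'c::euclidean_space"
  assumes B: "bounded_bilinear B"
    and "set_borel_measurable M K f" "set_borel_measurable M K g"
  shows "set_borel_measurable M K (\<lambda>x. B (f x) (g x))"
proof -
  have "(\<lambda>x. B (indicator K x *\<^sub>R f x) (indicator K x *\<^sub>R g x)) \<in> borel_measurable M"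
    using assms(2,3) unfolding set_borel_measurable_def
    by (rule borel_measurable_continuous_Pair)
      (auto intro!: bounded_bilinear.continuous_on[OF B] continuous_intros simp: split_beta)
  moreover have "B (indicator K x *\<^sub>R f x) (indicator K x *\<^sub>R g x) = indicator K x *\<^sub>R B (f x) (g x)" for x
    by (cases "x \<in> K") (simp_all add: bounded_bilinear.zero_left[OF B])
  ultimately show ?thesis by (simp add: set_borel_measurable_def)
qed

lemma set_borel_measurable_add:
  fixes f g :: "'x \<Rightarrow> 'b::euclidean_space"
  assumes "set_borel_measurable M K f" "set_borel_measurable M K g"
  shows "set_borel_measurable M K (\<lambda>x. f x + g x)"
  using assms unfolding set_borel_measurable_def scaleR_add_right by (rule borel_measurable_add)

lemma set_borel_measurable_norm_powr:
  fixes f :: "'x \<Rightarrow> 'b::euclidean_space"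
  assumes "set_borel_measurable M K f"
  shows "set_borel_measurable M K (\<lambda>x. norm (f x) powr p)"
proof -
  have "(\<lambda>x. norm (indicator K x *\<^sub>R f x) powr p) \<in> borel_measurable M"
    using assms unfolding set_borel_measurable_def by measurable
  moreover have "norm (indicator K x *\<^sub>R f x) powr p = indicator K x *\<^sub>R (norm (f x) powr p)" for x
    by (cases "x \<in> K") auto
  ultimately show ?thesis by (simp add: set_borel_measurable_def)
qed

lemma set_integrable_continuous:
  fixes f :: "'a::euclidean_space \<Rightarrow> 'b::euclidean_space"
  assumes "compact K" "continuous_on K f"
  shows "set_integrable lborel K f"
  using borel_integrable_compact[OF assms] by (simp add: set_integrable_def)

lemma Lp_imp_L1_on_compact:
  fixes G :: "'a::euclidean_space \<Rightarrow> 'b::euclidean_space"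
  assumes K: "compact K" and p: "1 \<le> p"
    and G: "set_borel_measurable lborel K G" "set_integrable lborel K (\<lambda>y. norm (G y) powr p)"
  shows "set_integrable lborel K G"
proof (rule set_integrable_bound[OF _ G(1)])
  show "set_integrable lborel K (\<lambda>y. 1 + norm (G y) powr p)"
    using set_integrable_continuous[OF K, of "\<lambda>y. 1::real"] G(2) by (intro set_integral_add(1)) auto
  have "norm (G y) \<le> 1 + norm (G y) powr p" for y
  proof (cases "norm (G y) \<ge> 1")
    case True
    then show ?thesis using powr_mono[OF p True] by simp
  next
    case False
    then show ?thesis using powr_ge_zero[of "norm (G y)" p] by linarith
  qed
  then show "AE y in lborel. y \<in> K \<longrightarrow> norm (G y) \<le> norm (1 + norm (G y) powr p)"
    by (intro AE_I2) (simp add: abs_of_nonneg add_nonneg_nonneg)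
qed

lemma Lp_product_on_compact:
  fixes B :: "'d::euclidean_space \<Rightarrow> 'b::euclidean_space \<Rightarrow> 'c::euclidean_space"
    and F :: "'a::euclidean_space \<Rightarrow> 'b"
  assumes B: "bounded_bilinear B" and K: "compact K" and p: "0 \<le> p"
    and cont: "continuous_on K \<Phi>" "continuous_on K \<Psi>" "continuous_on K F"
    and G: "set_borel_measurable lborel K G" "set_integrable lborel K (\<lambda>y. norm (G y) powr p)"
  shows "set_borel_measurable lborel K (\<lambda>y. B (\<Psi> y) (F y) + B (\<Phi> y) (G y))"
    and "set_integrable lborel K (\<lambda>y. norm (B (\<Psi> y) (F y) + B (\<Phi> y) (G y)) powr p)"
proof -
  let ?H = "\<lambda>y. B (\<Psi> y) (F y) + B (\<Phi> y) (G y)"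
  show meas: "set_borel_measurable lborel K ?H"
    using set_borel_measurable_continuous[OF K cont(1)] set_borel_measurable_continuous[OF K cont(2)]
      set_borel_measurable_continuous[OF K cont(3)] G(1)
    by (intro set_borel_measurable_add set_borel_measurable_bilinear[OF B]) auto
  obtain C1 where C1: "C1 > 0" "\<And>y. y \<in> K \<Longrightarrow> norm (B (\<Psi> y) (F y)) \<le> C1"
    using compact_continuous_bound[OF K bounded_bilinear.continuous_on[OF B cont(2,3)]] by blast
  obtain k where k: "k > 0" "\<And>x y. norm (B x y) \<le> norm x * norm y * k"
    using bounded_bilinear.pos_bounded[OF B] by blast
  obtain C2 where C2: "C2 > 0" "\<And>y. y \<in> K \<Longrightarrow> norm (\<Phi> y) \<le> C2"
    using compact_continuous_bound[OF K cont(1)] by blast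
  define C where "C = C1 + C2 * k"
  have C: "C > 0" using C1 C2 k by (simp add: C_def add_pos_pos)
  have bound: "norm (?H y) powr p \<le> C powr p * (1 + norm (G y) powr p)" if y: "y \<in> K" for y
  proof -
    \<comment> \<open>The maximum with 1 absorbs the term without \<open>G\<close>, so a single
      constant \<open>C\<close> bounds the sum; its power is at most
      \<open>1 + norm (G y) powr p\<close>.\<close>
    let ?m = "max 1 (norm (G y))"
    have "norm (\<Phi> y) * norm (G y) * k \<le> C2 * ?m * k"
      using C2 y k by (intro mult_mono) auto
    moreover have "C1 \<le> C1 * ?m" using C1 by simp
    moreover have "norm (?H y) \<le> norm (B (\<Psi> y) (F y)) + norm (B (\<Phi> y) (G y))"
      by (rule norm_triangle_ineq)
    ultimately have "norm (?H y) \<le> C1 * ?m + C2 * ?m * k"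
      using C1(2)[OF y] k(2)[of "\<Phi> y" "G y"] by linarith
    then have "norm (?H y) \<le> C * ?m" by (simp add: C_def algebra_simps)
    then have "norm (?H y) powr p \<le> (C * ?m) powr p"
      using p by (intro powr_mono2) auto
    also have "\<dots> = C powr p * ?m powr p"
      using C by (simp add: powr_mult)
    also have "\<dots> \<le> C powr p * (1 + norm (G y) powr p)"
      by (intro mult_left_mono) (auto simp: max_def)
    finally show ?thesis .
  qed
  have "set_integrable lborel K (\<lambda>y. C powr p * (1 + norm (G y) powr p))"
    using set_integrable_continuous[OF K, of "\<lambda>y. 1::real"] G(2)
    by (intro set_integrable_mult_right set_integral_add(1)) auto
  moreover have "AE y in lborel. y \<in> K \<longrightarrow>
      norm (norm (?H y) powr p) \<le> norm (C powr p * (1 + norm (G y) powr p))"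
    using bound by (intro AE_I2) (simp add: abs_of_nonneg add_nonneg_nonneg)
  ultimately show "set_integrable lborel K (\<lambda>y. norm (?H y) powr p)"
    by (rule set_integrable_bound[OF _ set_borel_measurable_norm_powr[OF meas]])
qed

lemma set_integrable_scaleR_continuous:
  fixes f :: "'a::euclidean_space \<Rightarrow> real" and G :: "'a \<Rightarrow> 'b::euclidean_space"
  assumes K: "compact K" and f: "continuous_on K f" and G: "set_integrable lborel K G"
  shows "set_integrable lborel K (\<lambda>y. f y *\<^sub>R G y)"
proof -
  obtain C where C: "C > 0" "\<And>y. y \<in> K \<Longrightarrow> norm (f y) \<le> C"
    using compact_continuous_bound[OF K f] by blast
  have "set_borel_measurable lborel K G"
    using G by (simp add: set_integrable_def set_borel_measurable_def)
  then have "set_borel_measurable lborel K (\<lambda>y. f y *\<^sub>R G y)"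
    by (intro set_borel_measurable_bilinear[OF bounded_bilinear_scaleR]
        set_borel_measurable_continuous[OF K f])
  then show ?thesis
    by (rule set_integrable_bound[where f = "\<lambda>y. C *\<^sub>R G y", rotated])
      (use C in \<open>auto intro!: set_integrable_scaleR_right G AE_I2 mult_right_mono\<close>)
qed

section \<open>Test functions and the weak product rule\<close>

lemma test_function_derivative_zero:
  assumes "compact K" "\<And>y. y \<notin> K \<Longrightarrow> \<eta> y = (0::real)" "y \<notin> K"
  shows "(\<eta> has_derivative (\<lambda>v. 0)) (at (y::real^'n::finite))"
proof (rule has_derivative_transform_within_open)
  show "((\<lambda>y. 0) has_derivative (\<lambda>v. 0)) (at y)" by simp
  show "open (- K)" using assms(1) by (simp add: compact_imp_closed open_Compl)
qed (use assms in auto)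

text \<open>Values of \<open>\<psi>\<close> off \<open>\<Omega>\<close> are arbitrary, hence the
  extension by zero. It is smooth on \<open>\<Omega>\<close> as a product and on the complement of
  the support set \<open>K\<close> as zero, and these open sets cover the space.\<close>

lemma test_function_mult:
  assumes \<Omega>: "open \<Omega>" and \<psi>: "\<And>k. Ck_on k \<Omega> \<psi>" and \<eta>: "test_function \<Omega> \<eta>"
  shows "test_function \<Omega> (\<lambda>y. if y \<in> \<Omega> then \<eta> y * \<psi> y else 0)" (is "test_function \<Omega> ?f")
proof -
  obtain K where K: "compact K" "K \<subseteq> \<Omega>" "\<And>y. y \<notin> K \<Longrightarrow> \<eta> y = 0" and ck: "\<And>k. Ck_on k UNIV \<eta>"
    using \<eta> by (auto simp: test_function_def)
  have "Ck_on k UNIV ?f" for k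
  proof (rule Ck_on_local)
    fix y
    show "\<exists>U. open U \<and> y \<in> U \<and> Ck_on k U ?f"
    proof (cases "y \<in> K")
      case True
      have "Ck_on k \<Omega> ?f"
        by (rule Ck_on_cong[OF \<Omega> Ck_on_mult[OF \<Omega> Ck_on_subset[OF ck] \<psi>]]) auto
      then show ?thesis using True K \<Omega> by blast
    next
      case False
      have "open (- K)" using K(1) by (simp add: compact_imp_closed open_Compl)
      moreover from this have "Ck_on k (- K) ?f"
        by (rule Ck_on_cong[OF _ Ck_on_0]) (use K in auto)
      ultimately show ?thesis using False by blast
    qed
  qed
  then show ?thesis using K unfolding test_function_def by (auto intro!: exI[of _ K])
qed

text \<open>The weak equation is applied to the test function \<open>\<eta> * \<psi>\<close> and its
  derivative expanded. The direction \<open>v\<close> is fixed, so \<open>G\<close> stands for one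
  directional weak derivative. Integrability is part of the conclusion because the vector-valued
  case interchanges these integrals with finite sums.\<close>

lemma weak_product_rule_real:
  fixes F G :: "real^'n::finite \<Rightarrow> 'b::euclidean_space"
  assumes \<Omega>: "open \<Omega>" and \<psi>: "\<And>k. Ck_on k \<Omega> \<psi>" and F: "continuous_on \<Omega> F"
    and G: "\<And>K. compact K \<Longrightarrow> K \<subseteq> \<Omega> \<Longrightarrow> set_integrable lborel K G"
    and weak: "\<And>\<eta>. test_function \<Omega> \<eta> \<Longrightarrow>
      (LINT y|lborel. frechet_derivative \<eta> (at y) v *\<^sub>R F y) = - (LINT y|lborel. \<eta> y *\<^sub>R G y)"
    and \<eta>: "test_function \<Omega> \<eta>"
  shows "integrable lborel (\<lambda>y. frechet_derivative \<eta> (at y) v *\<^sub>R \<psi> y *\<^sub>R F y)" (is "integrable _ ?a")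
    and "integrable lborel (\<lambda>y. \<eta> y *\<^sub>R (frechet_derivative \<psi> (at y) v *\<^sub>R F y + \<psi> y *\<^sub>R G y))"
      (is "integrable _ ?b")
    and "(LINT y|lborel. frechet_derivative \<eta> (at y) v *\<^sub>R \<psi> y *\<^sub>R F y)
      = - (LINT y|lborel. \<eta> y *\<^sub>R (frechet_derivative \<psi> (at y) v *\<^sub>R F y + \<psi> y *\<^sub>R G y))"
proof -
  obtain K where K: "compact K" "K \<subseteq> \<Omega>" "\<And>y. y \<notin> K \<Longrightarrow> \<eta> y = 0" and ck: "\<And>k. Ck_on k UNIV \<eta>"
    using \<eta> by (auto simp: test_function_def)
  have d0: "frechet_derivative \<eta> (at y) v = 0" if "y \<notin> K" for y
  proof -
    have "(\<lambda>v. 0) = frechet_derivative \<eta> (at y)"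
      by (intro frechet_derivative_at test_function_derivative_zero[OF K(1)]) (use K(3) that in auto)
    from fun_cong[OF this, of v] show ?thesis by simp
  qed
  have c: "continuous_on K \<eta>" "continuous_on K (\<lambda>y. frechet_derivative \<eta> (at y) v)"
    "continuous_on K \<psi>" "continuous_on K (\<lambda>y. frechet_derivative \<psi> (at y) v)" "continuous_on K F"
  proof -
    have "continuous_on UNIV \<eta>" "continuous_on UNIV (\<lambda>y. frechet_derivative \<eta> (at y) v)"
      using ck[of 0] ck[of 1] by simp_all
    then show "continuous_on K \<eta>" "continuous_on K (\<lambda>y. frechet_derivative \<eta> (at y) v)"
      by (simp_all add: continuous_on_subset[OF _ subset_UNIV])
    have "continuous_on \<Omega> \<psi>" "continuous_on \<Omega> (\<lambda>y. frechet_derivative \<psi> (at y) v)"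
      using \<psi>[of 0] \<psi>[of 1] by simp_all
    then show "continuous_on K \<psi>" "continuous_on K (\<lambda>y. frechet_derivative \<psi> (at y) v)"
      by (simp_all add: continuous_on_subset[OF _ K(2)])
    show "continuous_on K F" using F K(2) by (rule continuous_on_subset)
  qed
  have "set_integrable lborel K ?a"
    using c by (intro set_integrable_continuous K continuous_intros)
  moreover have "indicator K y *\<^sub>R ?a y = ?a y" for y
    using d0 by (cases "y \<in> K") auto
  ultimately show a: "integrable lborel ?a"
    by (simp only: set_integrable_def)
  let ?b1 = "\<lambda>y. \<eta> y *\<^sub>R frechet_derivative \<psi> (at y) v *\<^sub>R F y"
  let ?b2 = "\<lambda>y. \<eta> y *\<^sub>R \<psi> y *\<^sub>R G y"
  have "set_integrable lborel K ?b1"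
    using c by (intro set_integrable_continuous K continuous_intros)
  moreover have "indicator K y *\<^sub>R ?b1 y = ?b1 y" for y
    using K(3) by (cases "y \<in> K") auto
  ultimately have b1: "integrable lborel ?b1"
    by (simp only: set_integrable_def)
  have "set_integrable lborel K ?b2"
    by (intro set_integrable_scaleR_continuous K c G)
  moreover have "indicator K y *\<^sub>R ?b2 y = ?b2 y" for y
    using K(3) by (cases "y \<in> K") auto
  ultimately have b2: "integrable lborel ?b2"
    by (simp only: set_integrable_def)
  show "integrable lborel ?b"
    using b1 b2 by (simp add: scaleR_add_right)
  define \<zeta> where "\<zeta> = (\<lambda>y. if y \<in> \<Omega> then \<eta> y * \<psi> y else 0)"
  have \<zeta>: "test_function \<Omega> \<zeta>"
    unfolding \<zeta>_def by (rule test_function_mult[OF \<Omega> \<psi> \<eta>])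
  have d\<zeta>: "frechet_derivative \<zeta> (at y) v *\<^sub>R F y = ?a y + ?b1 y" for y
  proof (cases "y \<in> \<Omega>")
    case True
    have "((\<lambda>y. \<eta> y * \<psi> y) has_derivative
        (\<lambda>v. \<eta> y * frechet_derivative \<psi> (at y) v + frechet_derivative \<eta> (at y) v * \<psi> y)) (at y)"
      using ck[of 1] \<psi>[of 1] True
      by (intro has_derivative_mult) (auto simp flip: frechet_derivative_works)
    then have "(\<zeta> has_derivative
        (\<lambda>v. \<eta> y * frechet_derivative \<psi> (at y) v + frechet_derivative \<eta> (at y) v * \<psi> y)) (at y)"
      by (rule has_derivative_transform_within_open[OF _ \<Omega> True]) (simp add: \<zeta>_def)
    from frechet_derivative_at[OF this, symmetric] show ?thesis
      by (simp add: algebra_simps)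
  next
    case False
    then have y: "y \<notin> K" using K by auto
    have "(\<zeta> has_derivative (\<lambda>v. 0)) (at y)"
      by (rule test_function_derivative_zero[OF K(1) _ y]) (simp add: \<zeta>_def K(3))
    from frechet_derivative_at[OF this, symmetric] show ?thesis
      using y by (simp add: d0 K(3))
  qed
  have "(LINT y|lborel. ?a y) + (LINT y|lborel. ?b1 y) = (LINT y|lborel. frechet_derivative \<zeta> (at y) v *\<^sub>R F y)"
    using a b1 by (simp add: d\<zeta>)
  also have "\<dots> = - (LINT y|lborel. \<zeta> y *\<^sub>R G y)" by (rule weak[OF \<zeta>])
  also have "(\<lambda>y. \<zeta> y *\<^sub>R G y) = ?b2"
    using K(2,3) by (intro ext) (auto simp: \<zeta>_def)
  finally have "(LINT y|lborel. ?a y) = - ((LINT y|lborel. ?b1 y) + (LINT y|lborel. ?b2 y))"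
    by (simp add: algebra_simps)
  also have "\<dots> = - (LINT y|lborel. ?b y)"
    using b1 b2 by (simp add: scaleR_add_right)
  finally show "(LINT y|lborel. ?a y) = - (LINT y|lborel. ?b y)" .
qed

text \<open>Expanding \<open>\<Phi>\<close> in coordinates reduces to real factors
  \<open>\<Phi> y \<bullet> b\<close>, and each constant linear map \<open>B b\<close> passes
  through the integral.\<close>

proposition weak_product_rule:
  fixes F G :: "real^'n::finite \<Rightarrow> 'b::euclidean_space"
    and B :: "'d::euclidean_space \<Rightarrow> 'b \<Rightarrow> 'c::euclidean_space"
  assumes B: "bounded_bilinear B"
    and \<Omega>: "open \<Omega>" and \<Phi>: "\<And>k. Ck_on k \<Omega> \<Phi>" and F: "continuous_on \<Omega> F"
    and G: "\<And>K. compact K \<Longrightarrow> K \<subseteq> \<Omega> \<Longrightarrow> set_integrable lborel K G"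
    and weak: "\<And>\<eta>. test_function \<Omega> \<eta> \<Longrightarrow>
      (LINT y|lborel. frechet_derivative \<eta> (at y) v *\<^sub>R F y) = - (LINT y|lborel. \<eta> y *\<^sub>R G y)"
    and \<eta>: "test_function \<Omega> \<eta>"
  shows "(LINT y|lborel. frechet_derivative \<eta> (at y) v *\<^sub>R B (\<Phi> y) (F y))
      = - (LINT y|lborel. \<eta> y *\<^sub>R (B (frechet_derivative \<Phi> (at y) v) (F y) + B (\<Phi> y) (G y)))"
proof -
  interpret B: bounded_bilinear B by (fact B)
  let ?d = "\<lambda>b y. frechet_derivative (\<lambda>y. \<Phi> y \<bullet> b) (at y) v"
  have ck: "Ck_on k \<Omega> (\<lambda>y. \<Phi> y \<bullet> b)" for k b
    by (rule Ck_on_bounded_linear[OF bounded_linear_inner_left \<Omega> \<Phi>])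
  note rule = weak_product_rule_real[OF \<Omega> ck F G weak \<eta>]
  have expand: "B x y = (\<Sum>b\<in>Basis. B b ((x \<bullet> b) *\<^sub>R y))" for x y
    by (subst euclidean_representation[of x, symmetric])
      (simp only: B.sum_left B.scaleR_left B.scaleR_right)
  have d: "?d b y = frechet_derivative \<Phi> (at y) v \<bullet> b" if "y \<in> \<Omega>" for b y
  proof -
    have "(\<Phi> has_derivative frechet_derivative \<Phi> (at y)) (at y)"
      using \<Phi>[of 1] that by (auto simp flip: frechet_derivative_works)
    from fun_cong[OF frechet_derivative_at[OF has_derivative_inner_left[OF this, of b]], of v]
    show ?thesis by simp
  qed
  have \<eta>0: "\<eta> y = 0" if "y \<notin> \<Omega>" for y
    using \<eta> that by (auto simp: test_function_def)
  have "(LINT y|lborel. frechet_derivative \<eta> (at y) v *\<^sub>R B (\<Phi> y) (F y))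
      = (LINT y|lborel. (\<Sum>b\<in>Basis. B b (frechet_derivative \<eta> (at y) v *\<^sub>R (\<Phi> y \<bullet> b) *\<^sub>R F y)))"
    by (subst expand) (simp only: scaleR_sum_right B.scaleR_right)
  also have "\<dots> = (\<Sum>b\<in>Basis. B b (LINT y|lborel. frechet_derivative \<eta> (at y) v *\<^sub>R (\<Phi> y \<bullet> b) *\<^sub>R F y))"
    using rule(1) by (simp add: integral_bounded_linear[OF B.bounded_linear_right]
        integrable_bounded_linear[OF B.bounded_linear_right])
  also have "\<dots> = - (\<Sum>b\<in>Basis. B b (LINT y|lborel. \<eta> y *\<^sub>R (?d b y *\<^sub>R F y + (\<Phi> y \<bullet> b) *\<^sub>R G y)))"
    by (simp only: rule(3) B.minus_right sum_negf)
  also have "\<dots> = - (LINT y|lborel. (\<Sum>b\<in>Basis. B b (\<eta> y *\<^sub>R (?d b y *\<^sub>R F y + (\<Phi> y \<bullet> b) *\<^sub>R G y))))"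
    using rule(2) by (simp add: integral_bounded_linear[OF B.bounded_linear_right]
        integrable_bounded_linear[OF B.bounded_linear_right])
  also have "(\<lambda>y. \<Sum>b\<in>Basis. B b (\<eta> y *\<^sub>R (?d b y *\<^sub>R F y + (\<Phi> y \<bullet> b) *\<^sub>R G y)))
      = (\<lambda>y. \<eta> y *\<^sub>R (B (frechet_derivative \<Phi> (at y) v) (F y) + B (\<Phi> y) (G y)))"
  proof
    fix y
    show "(\<Sum>b\<in>Basis. B b (\<eta> y *\<^sub>R (?d b y *\<^sub>R F y + (\<Phi> y \<bullet> b) *\<^sub>R G y)))
      = \<eta> y *\<^sub>R (B (frechet_derivative \<Phi> (at y) v) (F y) + B (\<Phi> y) (G y))"
    \<comment> \<open>Off \<open>\<Omega>\<close> the derivative of \<open>\<Phi>\<close> may be an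
      unspecified value; it is multiplied by \<open>\<eta> y = 0\<close>.\<close>
    proof (cases "y \<in> \<Omega>")
      case True
      then show ?thesis
        by (simp only: d expand[of "frechet_derivative \<Phi> (at y) v"] expand[of "\<Phi> y"]
            B.scaleR_right B.add_right scaleR_sum_right sum.distrib scaleR_add_right)
    qed (simp add: \<eta>0 B.zero_right)
  qed
  finally show ?thesis .
qed

section \<open>Charts of the covering\<close>

lemma covering_space_openin_image:
  assumes cov: "covering_space C p S" and V: "openin (top_of_set C) V"
  shows "openin (top_of_set S) (p ` V)"
proof (subst openin_subopen, intro ballI)
  fix y assume "y \<in> p ` V"
  then obtain x where x: "x \<in> V" "y = p x" by blast
  then have xC: "x \<in> C" using V openin_imp_subset by blast
  then have "p x \<in> S" using cov by (auto simp: covering_space_def)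
  then obtain T v where T: "p x \<in> T" "openin (top_of_set S) T" "\<Union>v = C \<inter> p -` T"
    and h: "\<forall>u\<in>v. \<exists>q. homeomorphism u T p q"
    using cov unfolding covering_space_def by metis
  obtain u where u: "u \<in> v" "x \<in> u" using T(1,3) xC by blast
  obtain q where q: "homeomorphism u T p q" using h u by blast
  have "u \<subseteq> C" using T(3) u by blast
  then have "openin (top_of_set u) (u \<inter> V)"
    using V by (auto simp: openin_open)
  then have "openin (top_of_set T) (p ` (u \<inter> V))"
    using homeomorphism_imp_open_map[OF q] by blast
  then have "openin (top_of_set S) (p ` (u \<inter> V))"
    using T(2) openin_trans by blast
  then show "\<exists>W. openin (top_of_set S) W \<and> y \<in> W \<and> W \<subseteq> p ` V"
    using x u by blast
qed

text \<open>A sheet of the covering around \<open>x\<close>, cut down to the preimage of a chart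
  domain, carries a lifted chart.\<close>

lemma lifted_charts_cover:
  assumes cov: "covering_space Mt \<pi> M" and man: "oriented_manifold M \<A>" and x: "x \<in> Mt"
  obtains V c where "(V, c) \<in> lifted_charts Mt \<pi> \<A>" "x \<in> V"
proof -
  have cont: "continuous_on Mt \<pi>" and "\<pi> ` Mt = M"
    using cov by (auto simp: covering_space_def)
  then have "\<pi> x \<in> M" using x by blast
  then obtain U f where U: "(U, f) \<in> \<A>" "\<pi> x \<in> U"
    using man unfolding oriented_manifold_def by blast
  have oU: "openin (top_of_set M) U"
    using man U(1) unfolding oriented_manifold_def by blast
  obtain T v where T: "\<pi> x \<in> T" "\<Union>v = Mt \<inter> \<pi> -` T"
    and v: "\<forall>u\<in>v. openin (top_of_set Mt) u" "\<forall>u\<in>v. \<exists>q. homeomorphism u T \<pi> q"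
    using cov \<open>\<pi> x \<in> M\<close> unfolding covering_space_def by metis
  obtain u where u: "u \<in> v" "x \<in> u" using T x by blast
  then obtain q where q: "homeomorphism u T \<pi> q" using v by blast
  have "inj_on \<pi> u"
    using q by (intro inj_on_inverseI[of _ q]) (simp add: homeomorphism_def)
  moreover have "openin (top_of_set Mt) (Mt \<inter> \<pi> -` U)"
    using cont oU \<open>\<pi> ` Mt = M\<close> by (intro continuous_openin_preimage) auto
  then have "openin (top_of_set Mt) (u \<inter> (Mt \<inter> \<pi> -` U))"
    using u(1) v(1) by (metis openin_Int)
  ultimately have "(u \<inter> (Mt \<inter> \<pi> -` U), (U, f)) \<in> lifted_charts Mt \<pi> \<A>"
    using U(1) by (auto simp: lifted_charts_def intro: inj_on_subset)
  then show thesis using that u x U(2) by blast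
qed

text \<open>Chart expressions use \<open>inv_into\<close>, a choice function. The lifted chart is a
  continuous injective open map, so its continuous inverse exists and injectivity forces
  \<open>inv_into\<close> to agree with it.\<close>

lemma chart_image_homeomorphism:
  assumes cov: "covering_space Mt \<pi> M" and man: "oriented_manifold M \<A>"
    and V: "(V, c) \<in> lifted_charts Mt \<pi> \<A>"
  shows "\<exists>a. openin (top_of_set {y. 0 \<le> a \<bullet> y}) (chart_image \<pi> V c)"
    and "homeomorphism V (chart_image \<pi> V c) (snd c \<circ> \<pi>) (inv_into V (snd c \<circ> \<pi>))"
proof -
  obtain U f where c: "c = (U, f)" by (cases c)
  have cA: "(U, f) \<in> \<A>" and oV: "openin (top_of_set Mt) V" and inj: "inj_on \<pi> V" and VU: "\<pi> ` V \<subseteq> U"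
    using V by (auto simp: lifted_charts_def c)
  have cont: "continuous_on Mt \<pi>"
    using cov by (auto simp: covering_space_def)
  have VM: "V \<subseteq> Mt" using oV by (rule openin_imp_subset)
  obtain f' where f': "homeomorphism U (f ` U) f f'"
    using man cA unfolding oriented_manifold_def by blast
  obtain a where a: "openin (top_of_set {y. 0 \<le> a \<bullet> y}) (f ` U)"
    using man cA unfolding oriented_manifold_def by blast
  have UM: "U \<subseteq> M"
    using man cA unfolding oriented_manifold_def by blast
  have op: "openin (top_of_set (f ` U)) ((f \<circ> \<pi>) ` W)" if W: "openin (top_of_set Mt) W" "W \<subseteq> V" for W
  proof -
    have "openin (top_of_set M) (\<pi> ` W)"
      by (rule covering_space_openin_image[OF cov W(1)])
    then have "openin (top_of_set U) (\<pi> ` W)"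
      using W(2) VU UM by (intro openin_subset_trans[of M "\<pi> ` W" U]) auto
    then show ?thesis
      unfolding image_comp[symmetric] using homeomorphism_imp_open_map[OF f'] by blast
  qed
  show "\<exists>a. openin (top_of_set {y. 0 \<le> a \<bullet> y}) (chart_image \<pi> V c)"
    using openin_trans[OF op[OF oV order_refl] a] by (auto simp: chart_image_def c)
  let ?h = "f \<circ> \<pi>"
  have injf: "inj_on f U"
    using f' by (intro inj_on_inverseI[of _ f']) (simp add: homeomorphism_def)
  have injh: "inj_on ?h V"
    using inj injf VU by (intro comp_inj_on) (auto intro: inj_on_subset)
  have conth: "continuous_on V ?h"
    using cont VM VU f'
    by (intro continuous_on_compose) (auto simp: homeomorphism_def intro: continuous_on_subset)
  have "openin (top_of_set (?h ` V)) (?h ` W)" if "openin (top_of_set V) W" for W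
  proof (rule openin_subset_trans[of "f ` U"])
    show "openin (top_of_set (f ` U)) (?h ` W)"
      using op[of W] that oV openin_trans openin_imp_subset by blast
  qed (use that VU openin_imp_subset in \<open>auto simp: openin_imp_subset\<close>, blast dest: openin_imp_subset)
  then obtain k where k: "homeomorphism V (?h ` V) ?h k"
    using homeomorphism_injective_open_map[OF conth refl injh] by blast
  have "k y = inv_into V ?h y" if y: "y \<in> ?h ` V" for y
  proof -
    obtain x where x: "x \<in> V" "y = ?h x" using y by (rule imageE)
    show ?thesis
      unfolding x(2) using inv_into_f_f[OF injh x(1)] homeomorphism_apply1[OF k x(1)] by simp
  qed
  then have "continuous_on (?h ` V) (inv_into V ?h)"
    using continuous_on_eq[OF homeomorphism_cont2[OF k]] by blast
  then show "homeomorphism V (chart_image \<pi> V c) (snd c \<circ> \<pi>) (inv_into V (snd c \<circ> \<pi>))"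
    unfolding homeomorphism_def chart_image_def c snd_conv
    using conth injh by (auto simp only: inv_into_f_f inv_into_image_cancel f_inv_into_f order_refl)
qed

lemma fun_in_chart_apply:
  assumes "homeomorphism V (chart_image \<pi> V c) (snd c \<circ> \<pi>) (inv_into V (snd c \<circ> \<pi>))" "x \<in> V"
  shows "fun_in_chart \<pi> V c s (snd c (\<pi> x)) = s x"
  using assms by (auto simp: fun_in_chart_def homeomorphism_def)

lemma is_differential_continuous:
  assumes cov: "covering_space Mt \<pi> M" and man: "oriented_manifold M \<A>"
    and d: "is_differential \<A> Mt \<pi> s \<omega>"
  shows "continuous_on Mt s"
  unfolding continuous_on_def
proof
  fix x assume "x \<in> Mt"
  then obtain V c where V: "(V, c) \<in> lifted_charts Mt \<pi> \<A>" "x \<in> V"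
    using lifted_charts_cover[OF cov man] by blast
  note hom = chart_image_homeomorphism(2)[OF cov man V(1)]
  have "continuous_on (chart_image \<pi> V c) (fun_in_chart \<pi> V c s)"
    using d V(1) unfolding is_differential_def by (intro has_derivative_continuous_on) blast
  then have "continuous_on V (fun_in_chart \<pi> V c s \<circ> (snd c \<circ> \<pi>))"
    using homeomorphism_cont1[OF hom] homeomorphism_image1[OF hom] by (metis continuous_on_compose)
  then have "continuous_on V s"
    by (rule continuous_on_eq) (simp add: fun_in_chart_apply[OF hom])
  moreover obtain T where T: "open T" "V = Mt \<inter> T"
    using V(1) by (auto simp: lifted_charts_def openin_open)
  moreover have "at x within Mt = at x within V"
    using T V(2) by (intro at_within_nhd[of x T]) auto
  ultimately show "(s \<longlongrightarrow> s x) (at x within Mt)"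
    using V(2) by (simp add: continuous_on_def)
qed

text \<open>The two requirements use smoothness differently: \<open>L\<^sup>p\<close> bounds on
  compact sets that may touch the boundary need \<open>D\<close> continuous on the whole chart
  image, while the weak equation lives in the interior, where \<open>D\<close> is the Frechet
  derivative. The candidate \<open>\<theta>\<close> is prescribed only through its chart
  expressions, that is, at points of \<open>Mt\<close>.\<close>

proposition W1p_C0_bilinear:
  fixes B :: "'d::euclidean_space \<Rightarrow> 'b::euclidean_space \<Rightarrow> 'e::euclidean_space"
    and d\<phi> :: "'c::topological_space \<Rightarrow> real^'n::finite \<Rightarrow> 'd"
  assumes B: "bounded_bilinear B" and cov: "covering_space Mt \<pi> M" and man: "oriented_manifold M \<A>"
    and p: "1 \<le> p" and W: "W1p_C0 \<A> Mt \<pi> p s \<omega>"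
    and sm: "smooth_section \<A> Mt \<pi> \<phi>" and d: "is_differential \<A> Mt \<pi> \<phi> d\<phi>"
    and \<theta>: "\<And>V c y v. (V, c) \<in> lifted_charts Mt \<pi> \<A> \<Longrightarrow> y \<in> chart_image \<pi> V c \<Longrightarrow>
      form_in_chart \<A> \<pi> V c \<theta> y v = B (form_in_chart \<A> \<pi> V c d\<phi> y v) (fun_in_chart \<pi> V c s y)
        + B (fun_in_chart \<pi> V c \<phi> y) (form_in_chart \<A> \<pi> V c \<omega> y v)"
  shows "W1p_C0 \<A> Mt \<pi> p (\<lambda>x. B (\<phi> x) (s x)) \<theta>"
proof -
  have conts: "continuous_on Mt s" using W by (simp add: W1p_C0_def)
  have "continuous_on Mt (\<lambda>x. B (\<phi> x) (s x))"
    using bounded_bilinear.continuous_on[OF B is_differential_continuous[OF cov man d] conts] .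
  moreover have
    "(\<forall>K v. compact K \<and> K \<subseteq> chart_image \<pi> V c \<longrightarrow>
         set_borel_measurable lborel K (\<lambda>y. form_in_chart \<A> \<pi> V c \<theta> y v) \<and>
         set_integrable lborel K (\<lambda>y. norm (form_in_chart \<A> \<pi> V c \<theta> y v) powr p)) \<and>
     (\<forall>\<eta> v. test_function (interior (chart_image \<pi> V c)) \<eta> \<longrightarrow>
         (LINT y|lborel. frechet_derivative \<eta> (at y) v *\<^sub>R fun_in_chart \<pi> V c (\<lambda>x. B (\<phi> x) (s x)) y)
         = - (LINT y|lborel. \<eta> y *\<^sub>R form_in_chart \<A> \<pi> V c \<theta> y v))"
    if V: "(V, c) \<in> lifted_charts Mt \<pi> \<A>" for V c
  proof -
    define S where "S = chart_image \<pi> V c"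
    define F where "F = fun_in_chart \<pi> V c s"
    define G where "G = form_in_chart \<A> \<pi> V c \<omega>"
    define \<Phi> where "\<Phi> = fun_in_chart \<pi> V c \<phi>"
    define D where "D = form_in_chart \<A> \<pi> V c d\<phi>"
    define H where "H = form_in_chart \<A> \<pi> V c \<theta>"
    note hom = chart_image_homeomorphism(2)[OF cov man V]
    obtain a where S: "openin (top_of_set {y. 0 \<le> a \<bullet> y}) S"
      using chart_image_homeomorphism(1)[OF cov man V] by (auto simp: S_def)
    have H: "H y v = B (D y v) (F y) + B (\<Phi> y) (G y v)" if "y \<in> S" for y v
      using \<theta>[OF V] that by (simp add: S_def F_def G_def \<Phi>_def D_def H_def)
    have D: "(\<Phi> has_derivative D y) (at y within S)" if "y \<in> S" for y
      using d V that unfolding is_differential_def by (auto simp: S_def \<Phi>_def D_def)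
    have sm\<Phi>: "smooth_on S \<Phi>"
      using sm V unfolding smooth_section_def by (auto simp: S_def \<Phi>_def)
    have VM: "V \<subseteq> Mt" using V by (auto simp: lifted_charts_def dest: openin_imp_subset)
    have contF: "continuous_on S F"
    proof -
      have "continuous_on S (s \<circ> inv_into V (snd c \<circ> \<pi>))"
        using hom conts VM unfolding S_def
        by (intro continuous_on_compose) (auto simp: homeomorphism_def intro: continuous_on_subset)
      then show ?thesis by (simp add: F_def fun_in_chart_def o_def)
    qed
    have cont\<Phi>: "continuous_on S \<Phi>" using D by (rule has_derivative_continuous_on)
    have contD: "continuous_on S (\<lambda>y. D y v)" for v
      by (rule smooth_on_derivative_continuous[OF S sm\<Phi> D])
    have WG: "set_borel_measurable lborel K (\<lambda>y. G y v)"
      "set_integrable lborel K (\<lambda>y. norm (G y v) powr p)" if "compact K" "K \<subseteq> S" for K v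
      using W V that unfolding W1p_C0_def by (auto simp: Let_def S_def G_def)
    have weak: "(LINT y|lborel. frechet_derivative \<eta> (at y) v *\<^sub>R F y) = - (LINT y|lborel. \<eta> y *\<^sub>R G y v)"
      if "test_function (interior S) \<eta>" for \<eta> v
      using W V that unfolding W1p_C0_def by (auto simp: Let_def S_def G_def F_def)
    have "set_borel_measurable lborel K (\<lambda>y. H y v) \<and> set_integrable lborel K (\<lambda>y. norm (H y v) powr p)"
      if K: "compact K" "K \<subseteq> S" for K v
    proof -
      have eq: "indicator K y *\<^sub>R H y v = indicator K y *\<^sub>R (B (D y v) (F y) + B (\<Phi> y) (G y v))" for y
        using H K(2) by (cases "y \<in> K") auto
      have eq': "indicator K y *\<^sub>R (norm (H y v) powr p)
          = indicator K y *\<^sub>R (norm (B (D y v) (F y) + B (\<Phi> y) (G y v)) powr p)" for y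
        using H K(2) by (cases "y \<in> K") auto
      have "0 \<le> p" using p by simp
      from Lp_product_on_compact[OF B K(1) this continuous_on_subset[OF cont\<Phi> K(2)]
          continuous_on_subset[OF contD K(2)] continuous_on_subset[OF contF K(2)] WG[OF K]]
      show ?thesis
        unfolding set_borel_measurable_def set_integrable_def eq eq' by blast
    qed
    moreover have "(LINT y|lborel. frechet_derivative \<eta> (at y) v *\<^sub>R B (\<Phi> y) (F y))
        = - (LINT y|lborel. \<eta> y *\<^sub>R H y v)" if \<eta>: "test_function (interior S) \<eta>" for \<eta> v
    proof -
      have "(LINT y|lborel. frechet_derivative \<eta> (at y) v *\<^sub>R B (\<Phi> y) (F y))
        = - (LINT y|lborel. \<eta> y *\<^sub>R (B (frechet_derivative \<Phi> (at y) v) (F y) + B (\<Phi> y) (G y v)))"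
      proof (rule weak_product_rule[OF B open_interior smooth_on_interior[OF sm\<Phi>] _ _ weak \<eta>])
        show "continuous_on (interior S) F"
          using contF interior_subset by (rule continuous_on_subset)
        show "set_integrable lborel K (\<lambda>y. G y v)" if K: "compact K" "K \<subseteq> interior S" for K
        proof -
          have "K \<subseteq> S" using K(2) interior_subset by blast
          from Lp_imp_L1_on_compact[OF K(1) p WG[OF K(1) this]] show ?thesis .
        qed
      qed
      also have "(\<lambda>y. \<eta> y *\<^sub>R (B (frechet_derivative \<Phi> (at y) v) (F y) + B (\<Phi> y) (G y v)))
          = (\<lambda>y. \<eta> y *\<^sub>R H y v)"
      proof
        fix y
        show "\<eta> y *\<^sub>R (B (frechet_derivative \<Phi> (at y) v) (F y) + B (\<Phi> y) (G y v)) = \<eta> y *\<^sub>R H y v"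
        proof (cases "y \<in> interior S")
          case True
          then have yS: "y \<in> S" using interior_subset by blast
          have "(\<Phi> has_derivative D y) (at y)"
            using D[OF yS] at_within_interior[OF True] by simp
          then have "D y = frechet_derivative \<Phi> (at y)" by (rule frechet_derivative_at)
          then show ?thesis using H[OF yS] by simp
        next
          case False
          then have "\<eta> y = 0" using \<eta> by (auto simp: test_function_def)
          then show ?thesis by simp
        qed
      qed
      finally show ?thesis .
    qed
    moreover have "fun_in_chart \<pi> V c (\<lambda>x. B (\<phi> x) (s x)) = (\<lambda>y. B (\<Phi> y) (F y))"
      by (simp add: fun_eq_iff F_def \<Phi>_def fun_in_chart_def)
    ultimately show ?thesis
      unfolding S_def[symmetric] H_def[symmetric] by simp
  qed
  ultimately show ?thesis
    unfolding W1p_C0_def Let_def by blast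
qed

section \<open>The test section\<close>

text \<open>A map into so(m,1) is fixed by the linear projection \<open>skew_part\<close>.
  Differentiating this identity shows that its derivative is fixed too, by uniqueness of derivatives
  within the half-space.\<close>

lemma form_in_chart_skew:
  assumes cov: "covering_space Mt \<pi> M" and man: "oriented_manifold M \<A>"
    and so: "\<And>x. x \<in> Mt \<Longrightarrow> \<phi> x \<in> so_mink" and d: "is_differential \<A> Mt \<pi> \<phi> d\<phi>"
    and V: "(V, c) \<in> lifted_charts Mt \<pi> \<A>" and y: "y \<in> chart_image \<pi> V c"
  shows "skew_part (form_in_chart \<A> \<pi> V c d\<phi> y v) = form_in_chart \<A> \<pi> V c d\<phi> y v"
proof -
  let ?S = "chart_image \<pi> V c" and ?F = "fun_in_chart \<pi> V c \<phi>" and ?D = "form_in_chart \<A> \<pi> V c d\<phi> y"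
  obtain a where S: "openin (top_of_set {y. 0 \<le> a \<bullet> y}) ?S"
    using chart_image_homeomorphism(1)[OF cov man V] by blast
  have D: "(?F has_derivative ?D) (at y within ?S)"
    using d V y unfolding is_differential_def by blast
  have "V \<subseteq> Mt" using V by (auto simp: lifted_charts_def dest: openin_imp_subset)
  then have "inv_into V (snd c \<circ> \<pi>) z \<in> Mt" if "z \<in> ?S" for z
    using that by (metis chart_image_def inv_into_into subsetD)
  then have eq: "?F z = skew_part (?F z)" if "z \<in> ?S" for z
    using that so by (simp add: fun_in_chart_def skew_part_so_mink)
  have "((\<lambda>z. skew_part (?F z)) has_derivative (\<lambda>v. skew_part (?D v))) (at y within ?S)"
    by (rule bounded_linear.has_derivative[OF linear_skew_part[unfolded linear_conv_bounded_linear] D])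
  then have "(?F has_derivative (\<lambda>v. skew_part (?D v))) (at y within ?S)"
    by (rule has_derivative_transform[OF y eq, rotated])
  from fun_cong[OF has_derivative_unique_halfspace[OF S y this D]] show ?thesis .
qed

theorem theorem1p1:
  fixes M :: "'a::{t2_space, second_countable_topology} set"
    and \<A> :: "('a, 'n::finite) chart set"
    and g :: "('a, 'n) metric"
    and Mt :: "'c::topological_space set"
    and \<pi> :: "'c \<Rightarrow> 'a"
    and \<Gamma> :: "('m::finite) mink_mat set"
    and u :: "'a \<Rightarrow> 'm mink set"
    and \<rho> :: "('c \<Rightarrow> 'c) \<Rightarrow> 'm mink_mat"
    and ut :: "'c \<Rightarrow> 'm mink"
    and du :: "'c \<Rightarrow> real ^ 'n \<Rightarrow> 'm mink"
    and p :: real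
  assumes "compact M" and "oriented_manifold M \<A>" and "riemannian_metric M \<A> g"
    and "covering_space Mt \<pi> M" and "simply_connected Mt"
    and "closed_hyperbolic \<Gamma>"
    and "1 < p"
    and "continuous_map (top_of_set M) (hyp_quotient \<Gamma>) u"
    and "equivariant_lift Mt \<pi> \<Gamma> u \<rho> ut"
    and "W1p_C0_map \<A> Mt \<pi> \<rho> p ut du"
    and "Jp_Euler_Lagrange M \<A> g Mt \<pi> \<rho> p ut du"
  shows "weakly_coclosed_ad M \<A> g Mt \<pi> \<rho> (\<lambda>x v. mink_cross (S_du g \<pi> (p - 1) ut du x v) (ut x))"
  unfolding weakly_coclosed_ad_def
proof (intro allI impI, elim conjE)
  fix \<phi> d\<phi>
  assume \<phi>: "bundle_section Mt \<pi> \<rho> adjoint_action \<phi>" "\<forall>x\<in>Mt. \<phi> x \<in> so_mink"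
      "smooth_section \<A> Mt \<pi> \<phi>"
    and d\<phi>: "bundle_one_form Mt \<pi> \<rho> adjoint_action d\<phi>" "is_differential \<A> Mt \<pi> \<phi> d\<phi>"
    and supp: "supported_in_interior M \<A> Mt \<pi> \<phi>"
  note man = assms(2) and cov = assms(4)
  have \<rho>: "\<rho> \<gamma> \<in> SO_plus" and ut\<gamma>: "x \<in> Mt \<Longrightarrow> ut (\<gamma> x) = \<rho> \<gamma> *v ut x" if "\<gamma> \<in> deck_group Mt \<pi>" for \<gamma> x
    using assms(6,9) that by (auto simp: equivariant_lift_def closed_hyperbolic_def bundle_section_def)
  have du: "bundle_one_form Mt \<pi> \<rho> (*v) du" "W1p_C0 \<A> Mt \<pi> p ut du"
    and du_tan: "\<And>x. x \<in> Mt \<Longrightarrow> range (du x) \<subseteq> tangent_hyperboloid (ut x)"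
    using assms(10) by (auto simp: W1p_C0_map_def)
  define \<xi> where "\<xi> = (\<lambda>x. \<phi> x *v ut x)"
  \<comment> \<open>At points of \<open>Mt\<close> the form \<open>d\<phi>\<close> is already skew.  Using its skew part everywhere keeps the
    pointwise identity \<open>integrand\<close> true outside \<open>Mt\<close>, so that nothing has to be known about the
    measure \<open>riemannian_volume M \<A> g\<close>.\<close>
  define d\<xi> where "d\<xi> = (\<lambda>x v. skew_part (d\<phi> x v) *v ut x + (if x \<in> Mt then \<phi> x *v du x v else 0))"
  have \<xi>_section: "bundle_section Mt \<pi> \<rho> (*v) \<xi>"
    unfolding bundle_section_def
  proof (intro ballI)
    fix \<gamma> x assume \<gamma>: "\<gamma> \<in> deck_group Mt \<pi>" and x: "x \<in> Mt"
    show "\<xi> (\<gamma> x) = \<rho> \<gamma> *v \<xi> x"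
      using \<phi>(1) \<gamma> x
      by (simp add: \<xi>_def bundle_section_def ut\<gamma>[OF \<gamma> x] adjoint_action_mult_vec[OF \<rho>[OF \<gamma>]])
  qed
  have \<xi>_tangent: "\<forall>x\<in>Mt. \<xi> x \<in> tangent_hyperboloid (ut x)"
    using \<phi>(2) by (simp add: \<xi>_def tangent_hyperboloid_def mink_commute[of "_ *v _"] so_mink_mink_self)
  have d\<xi>_form: "bundle_one_form Mt \<pi> \<rho> (*v) d\<xi>"
    unfolding bundle_one_form_def
  proof (intro conjI ballI allI)
    fix x assume x: "x \<in> Mt"
    have l: "linear (d\<phi> x)" "linear (du x)"
      using d\<phi>(1) du(1) x by (auto simp: bundle_one_form_def)
    show "linear (d\<xi> x)"
      by (intro linearI) (simp_all add: d\<xi>_def x linear_add[OF l(1)] linear_add[OF l(2)] linear_cmul[OF l(1)]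
          linear_cmul[OF l(2)] linear_add[OF linear_skew_part] linear_cmul[OF linear_skew_part]
          matrix_vector_mult_add_rdistrib matrix_vector_right_distrib matrix_vector_mult_scaleR
          scaleR_add_right flip: scaleR_matrix_vector_assoc)
  next
    fix \<gamma> x v assume \<gamma>: "\<gamma> \<in> deck_group Mt \<pi>" and x: "x \<in> Mt"
    have "\<gamma> x \<in> Mt"
      using \<gamma> x by (auto simp: deck_group_def homeomorphism_def)
    moreover have "\<phi> (\<gamma> x) = adjoint_action (\<rho> \<gamma>) (\<phi> x)"
      using \<phi>(1) \<gamma> x by (simp add: bundle_section_def)
    moreover have "d\<phi> (\<gamma> x) v = adjoint_action (\<rho> \<gamma>) (d\<phi> x v)" "du (\<gamma> x) v = \<rho> \<gamma> *v du x v"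
      using d\<phi>(1) du(1) \<gamma> x by (auto simp: bundle_one_form_def)
    ultimately show "d\<xi> (\<gamma> x) v = \<rho> \<gamma> *v d\<xi> x v"
      using x by (simp add: d\<xi>_def ut\<gamma>[OF \<gamma> x] skew_part_adjoint_action[OF \<rho>[OF \<gamma>]]
          adjoint_action_mult_vec[OF \<rho>[OF \<gamma>]] matrix_vector_right_distrib)
  qed
  have bil: "bounded_bilinear ((*v) :: 'm mink_mat \<Rightarrow> 'm mink \<Rightarrow> 'm mink)"
    unfolding bilinear_conv_bounded_bilinear[symmetric] bilinear_def
    by (intro conjI allI linearI) (simp_all add: matrix_vector_mult_add_rdistrib
        matrix_vector_right_distrib matrix_vector_mult_scaleR scaleR_matrix_vector_assoc)
  have W: "W1p_C0 \<A> Mt \<pi> p \<xi> d\<xi>"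
    unfolding \<xi>_def
  proof (rule W1p_C0_bilinear[OF bil cov man _ du(2) \<phi>(3) d\<phi>(2)])
    fix V c y v assume V: "(V, c) \<in> lifted_charts Mt \<pi> \<A>" and y: "y \<in> chart_image \<pi> V c"
    have "V \<subseteq> Mt" using V by (auto simp: lifted_charts_def dest: openin_imp_subset)
    then have "inv_into V (snd c \<circ> \<pi>) y \<in> Mt"
      using y by (metis chart_image_def inv_into_into subsetD)
    then show "form_in_chart \<A> \<pi> V c d\<xi> y v
        = form_in_chart \<A> \<pi> V c d\<phi> y v *v fun_in_chart \<pi> V c ut y
          + fun_in_chart \<pi> V c \<phi> y *v form_in_chart \<A> \<pi> V c du y v"
      using form_in_chart_skew[OF cov man _ d\<phi>(2) V y, of v] \<phi>(2)
      by (simp add: form_in_chart_def Let_def d\<xi>_def fun_in_chart_def)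
  qed (use assms(7) in simp)
  have "{x \<in> Mt. \<xi> x \<noteq> 0} \<subseteq> {x \<in> Mt. \<phi> x \<noteq> 0}"
    by (auto simp: \<xi>_def)
  then have "closure (\<pi> ` {x \<in> Mt. \<xi> x \<noteq> 0}) \<subseteq> closure (\<pi> ` {x \<in> Mt. \<phi> x \<noteq> 0})"
    by (intro closure_mono image_mono)
  then have "supported_in_interior M \<A> Mt \<pi> \<xi>"
    using supp unfolding supported_in_interior_def by blast
  then have EL: "integral_M M \<A> g Mt \<pi> (\<lambda>x. form_pairing (g (\<pi> x)) mink
      (S_du g \<pi> (p - 1) ut du x) (pullback_LC ut d\<xi> x)) = 0"
    using assms(11) \<xi>_section \<xi>_tangent d\<xi>_form W unfolding Jp_Euler_Lagrange_def by blast
  have integrand: "form_pairing (g (\<pi> x)) (\<lambda>F G. trace (F ** G))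
        (\<lambda>v. mink_cross (S_du g \<pi> (p - 1) ut du x v) (ut x)) (d\<phi> x)
      = 2 * form_pairing (g (\<pi> x)) mink (S_du g \<pi> (p - 1) ut du x) (pullback_LC ut d\<xi> x)" for x
  proof -
    let ?S = "S_du g \<pi> (p - 1) ut du x"
    \<comment> \<open>The basis chosen in \<open>form_pairing\<close> depends on the metric alone,
      so both pairings are sums over the same \<open>N\<close>. The terms with
      \<open>\<phi> x *v du x b\<close> cancel only in total.\<close>
    define N where "N = (SOME B. orthonormal_basis UNIV (g (\<pi> x)) B)"
    have "(\<Sum>b\<in>N. mink (?S b) (pullback_LC ut d\<xi> x b)) = (\<Sum>b\<in>N. mink (?S b) (skew_part (d\<phi> x b) *v ut x))"
    proof (cases "x \<in> Mt")
      case False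
      then show ?thesis
        by (simp add: pullback_LC_def d\<xi>_def mink_skew_part)
    next
      case True
      then have "\<pi> x \<in> M" "ut x \<in> hyperboloid" "linear (du x)"
        using cov assms(9) du(1) by (auto simp: covering_space_def equivariant_lift_def bundle_one_form_def)
      moreover have "inner_product_on UNIV (g (\<pi> x))"
        using assms(3) \<open>\<pi> x \<in> M\<close> by (simp add: riemannian_metric_def)
      ultimately have "inner_product_map (g (\<pi> x)) (tangent_hyperboloid (ut x)) mink (du x)"
        using du_tan[OF True]
        by (intro inner_product_map.intro inner_product_on_tangent_hyperboloid bilinear_mink)
      note S_range = inner_product_map.S_op_range[OF this]
        and S_skew = inner_product_map.form_pairing_S_op_skew[OF this]
      have "mink (?S b) (ut x) = 0" for b
        using S_range[of "p - 1" b] by (simp add: S_du_def tangent_hyperboloid_def)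
      then have "mink (?S b) (pullback_LC ut d\<xi> x b)
          = mink (?S b) (skew_part (d\<phi> x b) *v ut x) + mink (?S b) (\<phi> x *v du x b)" for b
        by (simp add: pullback_LC_def d\<xi>_def True mink.add_right mink.scaleR_right)
      moreover have "(\<Sum>b\<in>N. mink (?S b) (\<phi> x *v du x b)) = 0"
        using S_skew[of "(*v) (\<phi> x)" "p - 1"] \<phi>(2) True
        by (simp add: so_mink_mink_self form_pairing_def N_def S_du_def)
      ultimately show ?thesis by (simp add: sum.distrib)
    qed
    then show ?thesis
      by (simp add: form_pairing_def N_def[symmetric] trace_mink_cross_skew_part sum_distrib_left)
  qed
  show "integral_M M \<A> g Mt \<pi> (\<lambda>x. form_pairing (g (\<pi> x)) (\<lambda>F G. trace (F ** G))
      (\<lambda>v. mink_cross (S_du g \<pi> (p - 1) ut du x v) (ut x)) (d\<phi> x)) = 0"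
    using EL by (simp add: integrand integral_M_def)
qed

end
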